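(* Let $(M,F)$ be an $n$-dimensional Finsler space and let $V$ be an arbitrary projective vector field on $(M,F)$. Then $$\mathcal L_{\hat V}\Big\{\mathcal R_{jl}+\frac{n+1}{2}\Sigma_{jl}\Big\}=0 ,$$ i.e. the tensor $Z_{jl}:=\mathcal R_{jl}+\frac{n+1}{2}\Sigma_{jl}$ is a projective invariant.
   Context: $M$ is a connected smooth $n$-dimensional manifold, $TM_0$ is the slit tangent bundle with standard local coordinates $(x^i,y^i)$. A Finsler metric is a function $F:TM\to[0,\infty)$, smooth on $TM_0$, positively 1-homogeneous in $y$, with $g_{ij}=\frac12[F^2]_{y^iy^j}$ positive definite on $TM_0$. Spray and Berwald connection: $G^i=\frac14 g^{ih}\{y^k[F^2]_{x^ky^h}-[F^2]_{x^h}\}$, $G^i_{\ j}=\partial G^i/\partial y^j$, $G^i_{\ jk}=\partial G^i_{\ j}/\partial y^k$, $\frac{\delta}{\delta x^k}=\frac{\partial}{\partial x^k}-G^i_{\ k}\frac{\partial}{\partial y^i}$. The subscript $_{.i}$ denotes $\partial/\partial y^i$; the subscript $_{|k}$ denotes the Berwald horizontal covariant derivative, $X_{i|k}=\frac{\delta X_i}{\delta x^k}-X_rG^r_{\ ik}$. S-curvature: $\mathbf S=G^m_{\ m}-y^m\frac{\partial}{\partial x^m}\ln\sigma_F$, where $\sigma_F(x)=\mathrm{Vol}(\mathbb B^n(1))/\mathrm{Vol}\{(y^i)\in\mathbb R^n: F(y^i\frac{\partial}{\partial x^i}|_x)<1\}$, and $\Sigma_{ij}=\frac1{n+1}(\mathbf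 S_{.i|j}-\mathbf S_{.j|i})$. Curvature: $R^i_{\ k}=2\frac{\partial G^i}{\partial x^k}-y^j\frac{\partial^2G^i}{\partial x^j\partial y^k}+2G^j\frac{\partial^2G^i}{\partial y^j\partial y^k}-\frac{\partial G^i}{\partial y^j}\frac{\partial G^j}{\partial y^k}$, $K^i_{\ jkl}=\frac13\{R^i_{\ k.l.j}-R^i_{\ l.k.j}\}$, $K_{jl}=K^i_{\ jil}$ (sum over $i$), and $\mathcal R_{jl}=\frac12(K_{jl}-K_{lj})$. For a vector field $V$, $\hat V=V^i\frac{\partial}{\partial x^i}+y^k\frac{\partial V^i}{\partial x^k}\frac{\partial}{\partial y^i}$ is its complete lift. For a tensor with components $T_{ij}(x,y)$, $\mathcal L_{\hat V}T_{ij}=\hat V(T_{ij})+T_{kj}\frac{\partial V^k}{\partial x^i}+T_{ik}\frac{\partial V^k}{\partial x^j}$; for the spray coefficients, $\mathcal L_{\hat V}G^i=\hat V(G^i)-G^k\frac{\partial V^i}{\partial x^k}+\frac12y^jy^k\frac{\partial^2V^i}{\partial x^j\partial x^k}$. $V$ is projective if there is a function $P$ on $TM_0$ with $\mathcal L_{\hat V}G^i=Py^i$. "Projective invariant" means annihilated by $\mathcal L_{\hat V}$ for every projective vector field $V$. *)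

theory Defs
  imports "HOL-Analysis.Analysis"
begin

section \<open>Partial derivatives and smoothness\<close>

definition partial :: "'b::real_normed_vector \<Rightarrow> ('b \<Rightarrow> real) \<Rightarrow> 'b \<Rightarrow> real" where
  "partial e f z = deriv (\<lambda>t. f (z + t *\<^sub>R e)) 0"

abbreviation pd :: "'n::finite \<Rightarrow> (real^'n \<Rightarrow> real) \<Rightarrow> real^'n \<Rightarrow> real" where
  "pd k \<equiv> partial (axis k 1)"

abbreviation pdx :: "'n::finite \<Rightarrow> ((real^'n) \<times> (real^'n) \<Rightarrow> real) \<Rightarrow> (real^'n) \<times> (real^'n) \<Rightarrow> real" where
  "pdx k \<equiv> partial (axis k 1, 0)"

abbreviation pdy :: "'n::finite \<Rightarrow> ((real^'n) \<times> (real^'n) \<Rightarrow> real) \<Rightarrow> (real^'n) \<times> (real^'n) \<Rightarrow> real" where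
  "pdy k \<equiv> partial (0, axis k 1)"

text \<open>Both predicates below are meant for open sets \<open>S\<close> of a finite-dimensional space.\<close>

primrec Ck_on :: "nat \<Rightarrow> ('b::real_normed_vector \<Rightarrow> 'c::real_normed_vector) \<Rightarrow> 'b set \<Rightarrow> bool" where
  "Ck_on 0 f S \<longleftrightarrow> continuous_on S f"
| "Ck_on (Suc k) f S \<longleftrightarrow>
     (\<forall>x\<in>S. f differentiable (at x)) \<and> (\<forall>v. Ck_on k (\<lambda>x. frechet_derivative f (at x) v) S)"

definition smooth_on :: "'b::real_normed_vector set \<Rightarrow> ('b \<Rightarrow> 'c::real_normed_vector) \<Rightarrow> bool" where
  "smooth_on S f \<longleftrightarrow> (\<forall>k. Ck_on k f S)"


section \<open>Smooth manifolds\<close>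

text \<open>A chart is a domain together with a coordinate map, whose values off the domain are
  irrelevant. The dimension of the manifold is \<open>CARD('n)\<close>. Atlases need not be maximal.\<close>

type_synonym ('a, 'n) chart = "'a set \<times> ('a \<Rightarrow> (real, 'n) vec)"

definition chart_range :: "('a, 'n::finite) chart \<Rightarrow> (real^'n) set" where
  "chart_range c = snd c ` fst c"

definition chart_inv :: "('a, 'n::finite) chart \<Rightarrow> real^'n \<Rightarrow> 'a" where
  "chart_inv c = inv_into (fst c) (snd c)"

definition transition :: "('a, 'n::finite) chart \<Rightarrow> ('a, 'n) chart \<Rightarrow> real^'n \<Rightarrow> real^'n" where
  "transition c d = (\<lambda>x. snd d (chart_inv c x))"

definition is_chart :: "'a topology \<Rightarrow> ('a, 'n::finite) chart \<Rightarrow> bool" where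
  "is_chart M c \<longleftrightarrow> openin M (fst c) \<and> open (chart_range c) \<and>
     homeomorphic_map (subtopology M (fst c)) (top_of_set (chart_range c)) (snd c)"

definition smooth_manifold :: "'a topology \<Rightarrow> ('a, 'n::finite) chart set \<Rightarrow> bool" where
  "smooth_manifold M A \<longleftrightarrow>
     Hausdorff_space M \<and> second_countable M \<and>
     (\<forall>c\<in>A. is_chart M c) \<and> (\<Union>c\<in>A. fst c) = topspace M \<and>
     (\<forall>c\<in>A. \<forall>d\<in>A. smooth_on (snd c ` (fst c \<inter> fst d)) (transition c d))"


section \<open>The tangent bundle\<close>

text \<open>A tangent vector at \<open>p\<close> is the family of its components in all charts around \<open>p\<close>,
  subject to the transformation law of contravariant vectors. It is set to zero on all other
  charts, so that equality and zero of tangent vectors are equality and zero of functions.\<close>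

type_synonym ('a, 'n) tvec = "('a, 'n) chart \<Rightarrow> (real, 'n) vec"

definition tangent_space :: "('a, 'n::finite) chart set \<Rightarrow> 'a \<Rightarrow> ('a, 'n) tvec set" where
  "tangent_space A p = {v.
     (\<forall>c\<in>A. \<forall>d\<in>A. p \<in> fst c \<inter> fst d \<longrightarrow>
        v d = frechet_derivative (transition c d) (at (snd c p)) (v c)) \<and>
     (\<forall>c. \<not> (c \<in> A \<and> p \<in> fst c) \<longrightarrow> v c = 0)}"

text \<open>\<open>coord_tvec A c x y\<close> is the tangent vector \<open>y\<^sup>i \<partial>/\<partial>x\<^sup>i\<close> at the point with coordinates
  \<open>x\<close> in the chart \<open>c\<close>.\<close>

definition coord_tvec :: "('a, 'n::finite) chart set \<Rightarrow> ('a, 'n) chart \<Rightarrow> real^'n \<Rightarrow> real^'n \<Rightarrow> ('a, 'n) tvec" where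
  "coord_tvec A c x y = (\<lambda>d. if d \<in> A \<and> chart_inv c x \<in> fst d
     then frechet_derivative (transition c d) (at x) y else 0)"

text \<open>Functions on \<open>TM\<close> (or on \<open>TM\<^sub>0\<close>) in the standard local coordinates \<open>(x, y)\<close> induced by a chart,
  and the coordinate domain of \<open>TM\<^sub>0\<close>.\<close>

definition TM_rep :: "('a, 'n::finite) chart set \<Rightarrow> ('a, 'n) chart \<Rightarrow> ('a \<Rightarrow> ('a, 'n) tvec \<Rightarrow> real)
    \<Rightarrow> (real^'n) \<times> (real^'n) \<Rightarrow> real" where
  "TM_rep A c f = (\<lambda>(x, y). f (chart_inv c x) (coord_tvec A c x y))"

definition slit_range :: "('a, 'n::finite) chart \<Rightarrow> ((real^'n) \<times> (real^'n)) set" where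
  "slit_range c = chart_range c \<times> (- {0})"

definition vf_rep :: "('a, 'n::finite) chart \<Rightarrow> ('a \<Rightarrow> ('a, 'n) tvec) \<Rightarrow> real^'n \<Rightarrow> real^'n" where
  "vf_rep c V = (\<lambda>x. V (chart_inv c x) c)"

definition smooth_vector_field ::
  "'a topology \<Rightarrow> ('a, 'n::finite) chart set \<Rightarrow> ('a \<Rightarrow> ('a, 'n) tvec) \<Rightarrow> bool" where
  "smooth_vector_field M A V \<longleftrightarrow>
     (\<forall>p\<in>topspace M. V p \<in> tangent_space A p) \<and>
     (\<forall>c\<in>A. smooth_on (chart_range c) (vf_rep c V))"


section \<open>Finsler metrics\<close>

text \<open>From here on, \<open>L\<close> stands for a Finsler metric in standard local coordinates \<open>z = (x, y)\<close>;
  the expressions are only meaningful for \<open>y \<noteq> 0\<close>.\<close>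

definition fund_tensor :: "((real^'n::finite) \<times> (real^'n) \<Rightarrow> real) \<Rightarrow> 'n \<Rightarrow> 'n \<Rightarrow> (real^'n) \<times> (real^'n) \<Rightarrow> real" where
  "fund_tensor L i j z = 1/2 * pdy j (pdy i (\<lambda>w. (L w)\<^sup>2)) z"

definition finsler_metric ::
  "'a topology \<Rightarrow> ('a, 'n::finite) chart set \<Rightarrow> ('a \<Rightarrow> ('a, 'n) tvec \<Rightarrow> real) \<Rightarrow> bool" where
  "finsler_metric M A F \<longleftrightarrow>
     (\<forall>p\<in>topspace M. \<forall>v\<in>tangent_space A p. 0 \<le> F p v) \<and>
     (\<forall>c\<in>A. smooth_on (slit_range c) (TM_rep A c F)) \<and>
     (\<forall>p\<in>topspace M. \<forall>v\<in>tangent_space A p. \<forall>t>0. F p (\<lambda>c. t *\<^sub>R v c) = t * F p v) \<and>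
     (\<forall>c\<in>A. \<forall>z\<in>slit_range c. \<forall>w. w \<noteq> 0 \<longrightarrow>
        (\<Sum>i\<in>UNIV. \<Sum>j\<in>UNIV. fund_tensor (TM_rep A c F) i j z * w $ i * w $ j) > 0)"

definition fund_tensor_inv :: "((real^'n::finite) \<times> (real^'n) \<Rightarrow> real) \<Rightarrow> 'n \<Rightarrow> 'n \<Rightarrow> (real^'n) \<times> (real^'n) \<Rightarrow> real" where
  "fund_tensor_inv L i h z = matrix_inv (\<chi> a b. fund_tensor L a b z) $ i $ h"

definition spray :: "((real^'n::finite) \<times> (real^'n) \<Rightarrow> real) \<Rightarrow> 'n \<Rightarrow> (real^'n) \<times> (real^'n) \<Rightarrow> real" where
  "spray L i z = 1/4 * (\<Sum>h\<in>UNIV. fund_tensor_inv L i h z *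
     ((\<Sum>k\<in>UNIV. snd z $ k * pdy h (pdx k (\<lambda>w. (L w)\<^sup>2)) z) - pdx h (\<lambda>w. (L w)\<^sup>2) z))"

text \<open>\<open>spray1 L i j\<close> is \<open>G\<^sup>i\<^sub>j\<close> and \<open>spray2 L i j k\<close> is \<open>G\<^sup>i\<^sub>j\<^sub>k\<close>.\<close>

definition spray1 :: "((real^'n::finite) \<times> (real^'n) \<Rightarrow> real) \<Rightarrow> 'n \<Rightarrow> 'n \<Rightarrow> (real^'n) \<times> (real^'n) \<Rightarrow> real" where
  "spray1 L i j = pdy j (spray L i)"

definition spray2 :: "((real^'n::finite) \<times> (real^'n) \<Rightarrow> real) \<Rightarrow> 'n \<Rightarrow> 'n \<Rightarrow> 'n \<Rightarrow> (real^'n) \<times> (real^'n) \<Rightarrow> real" where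
  "spray2 L i j k = pdy k (spray1 L i j)"

definition hor_deriv :: "((real^'n::finite) \<times> (real^'n) \<Rightarrow> real) \<Rightarrow> 'n
    \<Rightarrow> ((real^'n) \<times> (real^'n) \<Rightarrow> real) \<Rightarrow> (real^'n) \<times> (real^'n) \<Rightarrow> real" where
  "hor_deriv L k f z = pdx k f z - (\<Sum>i\<in>UNIV. spray1 L i k z * pdy i f z)"

text \<open>\<open>berwald_hcov L X i k\<close> is \<open>X\<^sub>i\<^sub>|\<^sub>k\<close>.\<close>

definition berwald_hcov :: "((real^'n::finite) \<times> (real^'n) \<Rightarrow> real)
    \<Rightarrow> ('n \<Rightarrow> (real^'n) \<times> (real^'n) \<Rightarrow> real) \<Rightarrow> 'n \<Rightarrow> 'n \<Rightarrow> (real^'n) \<times> (real^'n) \<Rightarrow> real" where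
  "berwald_hcov L X i k z = hor_deriv L k (X i) z - (\<Sum>r\<in>UNIV. X r z * spray2 L r i k z)"


section \<open>S-curvature\<close>

definition BH_density :: "((real^'n::finite) \<times> (real^'n) \<Rightarrow> real) \<Rightarrow> real^'n \<Rightarrow> real" where
  "BH_density L x = measure lebesgue (ball (0 :: real^'n) 1) / measure lebesgue {y. L (x, y) < 1}"

definition S_curv :: "((real^'n::finite) \<times> (real^'n) \<Rightarrow> real) \<Rightarrow> (real^'n) \<times> (real^'n) \<Rightarrow> real" where
  "S_curv L z = (\<Sum>m\<in>UNIV. spray1 L m m z)
     - (\<Sum>m\<in>UNIV. snd z $ m * pd m (\<lambda>x. ln (BH_density L x)) (fst z))"

definition Sigma_curv :: "((real^'n::finite) \<times> (real^'n) \<Rightarrow> real) \<Rightarrow> 'n \<Rightarrow> 'n \<Rightarrow> (real^'n) \<times> (real^'n) \<Rightarrow> real" where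
  "Sigma_curv L i j z = 1 / (real CARD('n) + 1) *
     (berwald_hcov L (\<lambda>r. pdy r (S_curv L)) i j z - berwald_hcov L (\<lambda>r. pdy r (S_curv L)) j i z)"


section \<open>Riemann curvature\<close>

text \<open>\<open>riem L i k\<close> is \<open>R\<^sup>i\<^sub>k\<close> and \<open>K_curv L i j k l\<close> is \<open>K\<^sup>i\<^sub>j\<^sub>k\<^sub>l\<close>.\<close>

definition riem :: "((real^'n::finite) \<times> (real^'n) \<Rightarrow> real) \<Rightarrow> 'n \<Rightarrow> 'n \<Rightarrow> (real^'n) \<times> (real^'n) \<Rightarrow> real" where
  "riem L i k z = 2 * pdx k (spray L i) z
     - (\<Sum>j\<in>UNIV. snd z $ j * pdx j (pdy k (spray L i)) z)
     + 2 * (\<Sum>j\<in>UNIV. spray L j z * pdy j (pdy k (spray L i)) z)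
     - (\<Sum>j\<in>UNIV. pdy j (spray L i) z * pdy k (spray L j) z)"

definition K_curv :: "((real^'n::finite) \<times> (real^'n) \<Rightarrow> real) \<Rightarrow> 'n \<Rightarrow> 'n \<Rightarrow> 'n \<Rightarrow> 'n
    \<Rightarrow> (real^'n) \<times> (real^'n) \<Rightarrow> real" where
  "K_curv L i j k l z = 1/3 * (pdy j (pdy l (riem L i k)) z - pdy j (pdy k (riem L i l)) z)"

definition K_ricci :: "((real^'n::finite) \<times> (real^'n) \<Rightarrow> real) \<Rightarrow> 'n \<Rightarrow> 'n \<Rightarrow> (real^'n) \<times> (real^'n) \<Rightarrow> real" where
  "K_ricci L j l z = (\<Sum>i\<in>UNIV. K_curv L i j i l z)"

definition R_antisym :: "((real^'n::finite) \<times> (real^'n) \<Rightarrow> real) \<Rightarrow> 'n \<Rightarrow> 'n \<Rightarrow> (real^'n) \<times> (real^'n) \<Rightarrow> real" where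
  "R_antisym L j l z = 1/2 * (K_ricci L j l z - K_ricci L l j z)"


section \<open>Lie derivatives along complete lifts\<close>

text \<open>In this section \<open>W\<close> is a vector field in local coordinates.\<close>

definition complete_lift :: "(real^'n::finite \<Rightarrow> real^'n)
    \<Rightarrow> ((real^'n) \<times> (real^'n) \<Rightarrow> real) \<Rightarrow> (real^'n) \<times> (real^'n) \<Rightarrow> real" where
  "complete_lift W f z = (\<Sum>i\<in>UNIV. W (fst z) $ i * pdx i f z)
     + (\<Sum>i\<in>UNIV. \<Sum>k\<in>UNIV. snd z $ k * pd k (\<lambda>x. W x $ i) (fst z) * pdy i f z)"

definition lie_tensor :: "(real^'n::finite \<Rightarrow> real^'n)
    \<Rightarrow> ('n \<Rightarrow> 'n \<Rightarrow> (real^'n) \<times> (real^'n) \<Rightarrow> real) \<Rightarrow> 'n \<Rightarrow> 'n \<Rightarrow> (real^'n) \<times> (real^'n) \<Rightarrow> real" where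
  "lie_tensor W T i j z = complete_lift W (T i j) z
     + (\<Sum>k\<in>UNIV. T k j z * pd i (\<lambda>x. W x $ k) (fst z))
     + (\<Sum>k\<in>UNIV. T i k z * pd j (\<lambda>x. W x $ k) (fst z))"

definition lie_spray :: "(real^'n::finite \<Rightarrow> real^'n)
    \<Rightarrow> ('n \<Rightarrow> (real^'n) \<times> (real^'n) \<Rightarrow> real) \<Rightarrow> 'n \<Rightarrow> (real^'n) \<times> (real^'n) \<Rightarrow> real" where
  "lie_spray W G i z = complete_lift W (G i) z
     - (\<Sum>k\<in>UNIV. G k z * pd k (\<lambda>x. W x $ i) (fst z))
     + 1/2 * (\<Sum>j\<in>UNIV. \<Sum>k\<in>UNIV. snd z $ j * snd z $ k * pd j (pd k (\<lambda>x. W x $ i)) (fst z))"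

definition projective_vector_field :: "'a topology \<Rightarrow> ('a, 'n::finite) chart set
    \<Rightarrow> ('a \<Rightarrow> ('a, 'n) tvec \<Rightarrow> real) \<Rightarrow> ('a \<Rightarrow> ('a, 'n) tvec) \<Rightarrow> bool" where
  "projective_vector_field M A F V \<longleftrightarrow> smooth_vector_field M A V \<and>
     (\<exists>P :: 'a \<Rightarrow> ('a, 'n) tvec \<Rightarrow> real. \<forall>c\<in>A. \<forall>z\<in>slit_range c. \<forall>i.
        lie_spray (vf_rep c V) (spray (TM_rep A c F)) i z = TM_rep A c P z * snd z $ i)"

text \<open>A covariant 2-tensor on \<open>TM\<^sub>0\<close> is given by its components \<open>T c j l\<close> in each chart \<open>c\<close>.\<close>

definition lie_vanishes :: "('a, 'n::finite) chart set \<Rightarrow> ('a \<Rightarrow> ('a, 'n) tvec)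
    \<Rightarrow> (('a, 'n) chart \<Rightarrow> 'n \<Rightarrow> 'n \<Rightarrow> (real^'n) \<times> (real^'n) \<Rightarrow> real) \<Rightarrow> bool" where
  "lie_vanishes A V T \<longleftrightarrow>
     (\<forall>c\<in>A. \<forall>z\<in>slit_range c. \<forall>j l. lie_tensor (vf_rep c V) (T c) j l z = 0)"

definition Z_tensor :: "('a, 'n::finite) chart set \<Rightarrow> ('a \<Rightarrow> ('a, 'n) tvec \<Rightarrow> real)
    \<Rightarrow> ('a, 'n) chart \<Rightarrow> 'n \<Rightarrow> 'n \<Rightarrow> (real^'n) \<times> (real^'n) \<Rightarrow> real" where
  "Z_tensor A F c j l z = R_antisym (TM_rep A c F) j l z
     + (real CARD('n) + 1) / 2 * Sigma_curv (TM_rep A c F) j l z"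

end

theory Submission
  imports Defs
begin

text \<open>
  The tensor \<open>Z\<close> vanishes identically, in every chart and for every Finsler metric, so its Lie
  derivative along a lifted vector field is zero.

  Put \<open>N = G\<^sup>m\<^sub>m\<close> and \<open>\<delta>\<^sub>k = \<partial>/\<partial>x\<^sup>k - G\<^sup>m\<^sub>k \<partial>/\<partial>y\<^sup>m\<close>. Differentiating the formula for \<open>R\<^sup>i\<^sub>k\<close> and
  antisymmetrising leaves only a multiple of the curvature of the nonlinear connection,
  \<open>R\<^sup>i\<^sub>k\<^sub>.\<^sub>l - R\<^sup>i\<^sub>l\<^sub>.\<^sub>k = 3 (\<delta>\<^sub>k G\<^sup>i\<^sub>l - \<delta>\<^sub>l G\<^sup>i\<^sub>k)\<close> (lemma \<open>pdy_riem_antisym\<close>). Applying \<open>\<partial>/\<partial>y\<^sup>i\<close> and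
  summing over \<open>i\<close>, the terms quadratic in \<open>G\<^sup>i\<^sub>j\<^sub>k\<close> cancel and
  \<open>\<R>\<^sub>j\<^sub>l = 1/2 (\<delta>\<^sub>j N\<^sub>.\<^sub>l - \<delta>\<^sub>l N\<^sub>.\<^sub>j)\<close> remains (lemma \<open>R_antisym_eq\<close>). On the other side
  \<open>S\<^sub>.\<^sub>j = N\<^sub>.\<^sub>j - \<partial>\<^sub>j ln \<sigma>\<close>, where \<open>\<sigma>\<close> depends on \<open>x\<close> alone. The Berwald coefficients are symmetric
  in their lower indices, and so are the second partial derivatives of \<open>ln \<sigma>\<close>, hence
  \<open>(n + 1)/2 \<Sigma>\<^sub>j\<^sub>l = 1/2 (\<delta>\<^sub>l N\<^sub>.\<^sub>j - \<delta>\<^sub>j N\<^sub>.\<^sub>l)\<close>, the negative of \<open>\<R>\<^sub>j\<^sub>l\<close>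
  (lemma \<open>R_antisym_Sigma_cancel\<close>).

  Two regularity facts support this computation. The spray is smooth, because by Cramer's rule
  the inverse of the fundamental tensor is rational in its entries (\<open>smooth_on_spray\<close>). The
  Busemann-Hausdorff density \<open>\<sigma>\<close> is of class C^2 (\<open>Ck_on_ln_BH_density\<close>). For the latter the
  volume of the unit ball of \<open>F(x, \<cdot>)\<close> is replaced by the integral of \<open>\<phi>(F(x, y))\<close> over \<open>y\<close>
  for a fixed bump function \<open>\<phi>\<close> supported away from \<open>0\<close>. By homogeneity, volume and integral differ
  only by a constant factor (\<open>homogeneous_unit_ball_volume\<close>), and the integral can be differentiated
  under the integral sign, since the singularity of \<open>F\<close> at \<open>y = 0\<close> has been cut off.
\<close>

section \<open>Functions of class C^k\<close>

lemma frechet_derivative_cong_open: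
  assumes "open S" "x \<in> S" "\<And>x. x \<in> S \<Longrightarrow> f x = g x"
  shows "frechet_derivative f (at x) = frechet_derivative g (at x)"
proof -
  have "(f has_derivative D) (at x) \<longleftrightarrow> (g has_derivative D) (at x)" for D
    using assms has_derivative_transform_within_open[of f D x UNIV S g]
      has_derivative_transform_within_open[of g D x UNIV S f] by auto
  then show ?thesis by (simp add: frechet_derivative_def)
qed

lemma differentiable_cong_open:
  assumes "open S" "x \<in> S" "\<And>x. x \<in> S \<Longrightarrow> f x = g x" "f differentiable (at x)"
  shows "g differentiable (at x)"
  using assms has_derivative_transform_within_open[of f _ x UNIV S g]
  unfolding differentiable_def by blast

lemma Ck_on_cong:
  assumes "open S" "\<And>x. x \<in> S \<Longrightarrow> f x = g x" "Ck_on k f S"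
  shows "Ck_on k g S"
  using assms(2,3)
proof (induction k arbitrary: f g)
  case 0
  then show ?case by (simp cong: continuous_on_cong)
next
  case (Suc k)
  have "Ck_on k (\<lambda>x. frechet_derivative g (at x) v) S" for v
  proof (rule Suc.IH)
    show "Ck_on k (\<lambda>x. frechet_derivative f (at x) v) S" using Suc.prems(2) by simp
    show "frechet_derivative f (at x) v = frechet_derivative g (at x) v" if "x \<in> S" for x
      using frechet_derivative_cong_open[OF assms(1) that, of f g] Suc.prems(1) by simp
  qed
  then show ?case
    using Suc.prems differentiable_cong_open[OF assms(1), of _ f g] by auto
qed

lemma Ck_on_Suc_lower: "Ck_on (Suc k) f S \<Longrightarrow> Ck_on k f S"
proof (induction k arbitrary: f)
  case 0
  then show ?case
    by (auto intro!: differentiable_imp_continuous_on differentiable_at_imp_differentiable_on)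
next
  case (Suc k)
  from Suc.prems have "\<forall>v. Ck_on (Suc k) (\<lambda>x. frechet_derivative f (at x) v) S"
    and "\<forall>x\<in>S. f differentiable (at x)"
    unfolding Ck_on.simps(2)[of "Suc k" f] by blast+
  with Suc.IH show ?case unfolding Ck_on.simps(2)[of k f] by blast
qed

lemma Ck_on_subset: "Ck_on k f S \<Longrightarrow> T \<subseteq> S \<Longrightarrow> Ck_on k f T"
  by (induction k arbitrary: f) (auto intro: continuous_on_subset)

lemma Ck_on_Un:
  assumes "open S" "open T" "Ck_on k f S" "Ck_on k f T"
  shows "Ck_on k f (S \<union> T)"
  using assms(3,4) by (induction k arbitrary: f) (auto intro: continuous_on_open_Un assms)

text \<open>The derivative need not be presented as a Frechet derivative chosen by the operator
  \<open>frechet_derivative\<close>; any explicit formula for it will do. The closure properties below rest on this rule.\<close>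

lemma Ck_on_SucI:
  assumes "open S" "\<And>x. x \<in> S \<Longrightarrow> (f has_derivative D x) (at x)"
    and "\<And>v. Ck_on k (\<lambda>x. D x v) S"
  shows "Ck_on (Suc k) f S"
proof -
  have "Ck_on k (\<lambda>x. frechet_derivative f (at x) v) S" for v
    by (rule Ck_on_cong[OF assms(1) _ assms(3)])
      (simp flip: frechet_derivative_at[OF assms(2)])
  moreover have "f differentiable (at x)" if "x \<in> S" for x
    using assms(2)[OF that] unfolding differentiable_def by blast
  ultimately show ?thesis by simp
qed

lemma Ck_on_has_derivative:
  "Ck_on (Suc k) f S \<Longrightarrow> x \<in> S \<Longrightarrow> (f has_derivative frechet_derivative f (at x)) (at x)"
  using frechet_derivative_works[of f "at x"] by simp

lemma Ck_on_const: "open S \<Longrightarrow> Ck_on k (\<lambda>x. c) S"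
proof (induction k arbitrary: c)
  case (Suc k)
  then show ?case by (intro Ck_on_SucI[where D="\<lambda>x v. 0"] has_derivative_const) auto
qed simp

lemma Ck_on_bounded_linear:
  assumes "open S" "bounded_linear f" shows "Ck_on k f S"
proof (cases k)
  case 0
  then show ?thesis using assms(2) by (auto intro: linear_continuous_on)
next
  case (Suc m)
  show ?thesis unfolding Suc
    by (rule Ck_on_SucI[where D="\<lambda>x. f", OF assms(1) bounded_linear_imp_has_derivative[OF assms(2)]
          Ck_on_const[OF assms(1)]])
qed

lemma Ck_on_add:
  fixes f g :: "'b::real_normed_vector \<Rightarrow> real"
  assumes "open S" shows "Ck_on k f S \<Longrightarrow> Ck_on k g S \<Longrightarrow> Ck_on k (\<lambda>x. f x + g x) S"
proof (induction k arbitrary: f g)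
  case 0 then show ?case by (auto intro: continuous_intros)
next
  case (Suc k)
  show ?case
    by (rule Ck_on_SucI[OF assms
          has_derivative_add[OF Ck_on_has_derivative[OF Suc.prems(1)] Ck_on_has_derivative[OF Suc.prems(2)]]])
      (use Suc in auto)
qed

lemma Ck_on_mult:
  fixes f g :: "'b::real_normed_vector \<Rightarrow> real"
  assumes "open S" shows "Ck_on k f S \<Longrightarrow> Ck_on k g S \<Longrightarrow> Ck_on k (\<lambda>x. f x * g x) S"
proof (induction k arbitrary: f g)
  case 0 then show ?case by (auto intro: continuous_intros)
next
  case (Suc k)
  show ?case
    by (rule Ck_on_SucI[OF assms
          has_derivative_mult[OF Ck_on_has_derivative[OF Suc.prems(1)] Ck_on_has_derivative[OF Suc.prems(2)]]])
      (use Suc.prems in \<open>auto intro!: Ck_on_add assms Suc.IH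
          Ck_on_Suc_lower[OF Suc.prems(1)] Ck_on_Suc_lower[OF Suc.prems(2)]\<close>)
qed

lemma Ck_on_inverse:
  fixes f :: "'b::real_normed_vector \<Rightarrow> real"
  assumes "open S" "\<And>x. x \<in> S \<Longrightarrow> f x \<noteq> 0"
  shows "Ck_on k f S \<Longrightarrow> Ck_on k (\<lambda>x. inverse (f x)) S"
proof (induction k)
  case 0 then show ?case using assms by (auto intro: continuous_intros)
next
  case (Suc k)
  have f: "Ck_on k f S" using Suc.prems by (rule Ck_on_Suc_lower)
  show ?case
  proof (rule Ck_on_SucI[OF assms(1)])
    show "((\<lambda>x. inverse (f x)) has_derivative
        (\<lambda>h. (- 1) * (inverse (f x) * frechet_derivative f (at x) h * inverse (f x)))) (at x)"
      if "x \<in> S" for x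
      using Deriv.has_derivative_inverse[OF assms(2)[OF that] Ck_on_has_derivative[OF Suc.prems that]]
      by simp
    show "Ck_on k (\<lambda>x. (- 1) * (inverse (f x) * frechet_derivative f (at x) v * inverse (f x))) S" for v
      using Suc.prems by (intro Ck_on_mult Ck_on_const assms(1) Suc.IH f) auto
  qed
qed

lemma Ck_on_ln:
  fixes f :: "'b::real_normed_vector \<Rightarrow> real"
  assumes "open S" "\<And>x. x \<in> S \<Longrightarrow> f x > 0" "Ck_on k f S"
  shows "Ck_on k (\<lambda>x. ln (f x)) S"
proof (cases k)
  case 0 then show ?thesis using assms by (force intro: continuous_intros)
next
  case (Suc m)
  have f: "Ck_on (Suc m) f S" using assms Suc by simp
  show ?thesis unfolding Suc
  proof (rule Ck_on_SucI[OF assms(1)])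
    show "((\<lambda>x. ln (f x)) has_derivative
        (\<lambda>h. inverse (f x) * frechet_derivative f (at x) h)) (at x)" if "x \<in> S" for x
      by (rule derivative_eq_intros Ck_on_has_derivative[OF f that] assms(2) that refl)+
        (simp add: divide_inverse mult.commute)
    have "f x \<noteq> 0" if "x \<in> S" for x using assms(2)[OF that] by simp
    then show "Ck_on m (\<lambda>x. inverse (f x) * frechet_derivative f (at x) v) S" for v
      using f by (intro Ck_on_mult Ck_on_inverse assms(1) Ck_on_Suc_lower[OF f]) auto
  qed
qed

lemma has_real_derivative_pos_part_power:
  "((\<lambda>t::real. (max 0 t) ^ Suc (Suc k)) has_real_derivative real (Suc (Suc k)) * (max 0 t) ^ Suc k) (at t)"
proof -
  consider "t < 0" | "t > 0" | "t = 0" by linarith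
  then show ?thesis
  proof cases
    case 1
    have "((\<lambda>t::real. 0) has_real_derivative 0) (at t)" by simp
    then have "((\<lambda>t::real. (max 0 t) ^ Suc (Suc k)) has_real_derivative 0) (at t)"
      by (rule has_field_derivative_transform_within_open[of _ _ _ "{..<0}"]) (use 1 in auto)
    then show ?thesis using 1 by simp
  next
    case 2
    have "((\<lambda>t::real. t ^ Suc (Suc k)) has_real_derivative real (Suc (Suc k)) * t ^ Suc k) (at t)"
      by (rule derivative_eq_intros refl)+ simp
    then have "((\<lambda>t::real. (max 0 t) ^ Suc (Suc k)) has_real_derivative real (Suc (Suc k)) * t ^ Suc k) (at t)"
      by (rule has_field_derivative_transform_within_open[of _ _ _ "{0<..}"]) (use 2 in \<open>auto simp: max_def\<close>)
    then show ?thesis using 2 by (simp add: max_def)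
  next
    case 3
    have "((\<lambda>h::real. (max 0 h) ^ Suc (Suc k) / h) \<longlongrightarrow> 0) (at 0)"
    proof (rule Lim_transform_eventually)
      have "((\<lambda>h::real. (max 0 h) ^ Suc k) \<longlongrightarrow> (max 0 0) ^ Suc k) (at 0)"
        by (intro tendsto_intros)
      then show "((\<lambda>h::real. (max 0 h) ^ Suc k) \<longlongrightarrow> 0) (at 0)" by simp
      show "\<forall>\<^sub>F h in at 0. (max 0 h) ^ Suc k = (max 0 h) ^ Suc (Suc k) / (h::real)"
        by (auto simp: eventually_at_filter max_def)
    qed
    then show ?thesis using 3 by (simp add: DERIV_def)
  qed
qed

text \<open>Each differentiation of a power of the positive part costs one factor, so the exponent bounds the
  number of continuous derivatives. This supplies cutoff functions of any finite order of
  differentiability.\<close>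

lemma Ck_on_pos_part_power:
  fixes f :: "'b::real_normed_vector \<Rightarrow> real"
  assumes "open S"
  shows "Ck_on k f S \<Longrightarrow> Ck_on k (\<lambda>x. (max 0 (f x)) ^ Suc k) S"
proof (induction k)
  case 0 then show ?case by (auto intro!: continuous_intros)
next
  case (Suc k)
  have f: "Ck_on k f S" using Suc.prems by (rule Ck_on_Suc_lower)
  show ?case
  proof (rule Ck_on_SucI[OF assms(1)])
    show "((\<lambda>x. max 0 (f x) ^ Suc (Suc k)) has_derivative
        (\<lambda>h. real (Suc (Suc k)) * max 0 (f x) ^ Suc k * frechet_derivative f (at x) h)) (at x)"
      if "x \<in> S" for x
      using has_derivative_compose[OF Ck_on_has_derivative[OF Suc.prems that]
          has_real_derivative_pos_part_power[THEN has_field_derivative_imp_has_derivative]]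
      by simp
    show "Ck_on k (\<lambda>x. real (Suc (Suc k)) * max 0 (f x) ^ Suc k * frechet_derivative f (at x) v) S" for v
      using Suc.prems by (intro Ck_on_mult Ck_on_const assms(1) Suc.IH f) auto
  qed
qed

section \<open>Directional derivatives of smooth functions\<close>

lemma has_real_derivative_along_line:
  fixes f :: "'b::real_normed_vector \<Rightarrow> real"
  assumes "f differentiable (at (w + s *\<^sub>R e))"
  shows "((\<lambda>s. f (w + s *\<^sub>R e)) has_real_derivative frechet_derivative f (at (w + s *\<^sub>R e)) e) (at s)"
proof -
  let ?D = "frechet_derivative f (at (w + s *\<^sub>R e))"
  have D: "(f has_derivative ?D) (at (w + s *\<^sub>R e))"
    using assms by (simp add: frechet_derivative_works)
  have "((\<lambda>s. w + s *\<^sub>R e) has_derivative (\<lambda>h. h *\<^sub>R e)) (at s)"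
    by (auto intro!: derivative_eq_intros)
  from has_derivative_compose[OF this D]
  have "((\<lambda>s. f (w + s *\<^sub>R e)) has_derivative (\<lambda>h. ?D (h *\<^sub>R e))) (at s)" .
  moreover have "(\<lambda>h. ?D (h *\<^sub>R e)) = (*) (?D e)"
    using has_derivative_bounded_linear[OF D]
    by (auto simp: linear_simps bounded_linear.linear linear_scale)
  ultimately show ?thesis by (simp add: has_field_derivative_def)
qed

lemma partial_eq_frechet_derivative:
  fixes f :: "'b::real_normed_vector \<Rightarrow> real"
  assumes "f differentiable (at z)"
  shows "partial e f z = frechet_derivative f (at z) e"
  using has_real_derivative_along_line[of f z 0 e] assms
  by (auto simp: partial_def intro!: DERIV_imp_deriv)

lemma partial_has_real_derivative:
  fixes f :: "'b::real_normed_vector \<Rightarrow> real"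
  assumes "f differentiable (at (w + s *\<^sub>R e))"
  shows "((\<lambda>s. f (w + s *\<^sub>R e)) has_real_derivative partial e f (w + s *\<^sub>R e)) (at s)"
  using has_real_derivative_along_line[OF assms] partial_eq_frechet_derivative[OF assms] by simp

lemma partial_cong_open:
  assumes "open S" "z \<in> S" "\<And>x. x \<in> S \<Longrightarrow> f x = g x"
  shows "partial e f z = partial e g z"
proof -
  have "((\<lambda>t. z + t *\<^sub>R e) \<longlongrightarrow> z + 0 *\<^sub>R e) (nhds 0)"
    by (intro tendsto_intros filterlim_ident)
  then have "\<forall>\<^sub>F t in nhds 0. z + t *\<^sub>R e \<in> S"
    using assms(1,2) by (auto elim: topological_tendstoD)
  then have "\<forall>\<^sub>F t in nhds 0. f (z + t *\<^sub>R e) = g (z + t *\<^sub>R e)"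
    by (rule eventually_mono) (use assms in auto)
  then show ?thesis unfolding partial_def by (intro deriv_cong_ev) auto
qed

lemma Ck_on_partial:
  fixes f :: "'b::real_normed_vector \<Rightarrow> real"
  assumes "open S" "Ck_on (Suc k) f S" shows "Ck_on k (partial e f) S"
  using assms Ck_on_cong[of S "\<lambda>x. frechet_derivative f (at x) e" "partial e f" k]
  by (auto simp: partial_eq_frechet_derivative)

text \<open>The mean value theorem applied once in each direction expresses the second difference by a mixed
  partial derivative. The second difference is symmetric in the two directions, which forces the two
  mixed partial derivatives to agree in the limit.\<close>

lemma second_difference_mean_value:
  fixes f :: "'b::real_normed_vector \<Rightarrow> real"
  assumes f: "\<And>w. w \<in> ball z r \<Longrightarrow> f differentiable (at w)"
    and fe: "\<And>w. w \<in> ball z r \<Longrightarrow> partial e f differentiable (at w)"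
    and h: "h > 0" "h * (norm e + norm d) < r"
  shows "\<exists>w. dist z w \<le> h * (norm e + norm d) \<and>
    f (z + h *\<^sub>R e + h *\<^sub>R d) - f (z + h *\<^sub>R e) - f (z + h *\<^sub>R d) + f z
      = h * h * partial d (partial e f) w"
proof -
  have near: "dist z (z + s *\<^sub>R e + t *\<^sub>R d) \<le> h * (norm e + norm d)"
    if "0 \<le> s" "s \<le> h" "0 \<le> t" "t \<le> h" for s t
  proof -
    have "dist z (z + s *\<^sub>R e + t *\<^sub>R d) \<le> norm (s *\<^sub>R e) + norm (t *\<^sub>R d)"
      by (metis add.assoc add_diff_cancel_left' dist_commute dist_norm norm_triangle_ineq)
    also have "\<dots> \<le> h * norm e + h * norm d"
      using that by (auto intro!: add_mono mult_right_mono)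
    finally show ?thesis by (simp add: algebra_simps)
  qed
  have inball: "z + s *\<^sub>R e + t *\<^sub>R d \<in> ball z r"
    if "0 \<le> s" "s \<le> h" "0 \<le> t" "t \<le> h" for s t
    using near[OF that] h by simp
  have swap: "z + a + b = z + b + a" for a b :: 'b by (simp add: algebra_simps)
  define u where "u s = f (z + h *\<^sub>R d + s *\<^sub>R e) - f (z + s *\<^sub>R e)" for s
  have "\<exists>s. 0 < s \<and> s < h \<and> u h - u 0 = (h - 0) *
     (partial e f (z + h *\<^sub>R d + s *\<^sub>R e) - partial e f (z + s *\<^sub>R e))"
  proof (rule MVT2)
    fix s assume s: "0 \<le> s" "s \<le> h"
    have 1: "f differentiable (at (z + h *\<^sub>R d + s *\<^sub>R e))" and 2: "f differentiable (at (z + s *\<^sub>R e))"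
      using f inball[of s h] inball[of s 0] s h by (auto simp: swap)
    show "(u has_real_derivative partial e f (z + h *\<^sub>R d + s *\<^sub>R e) - partial e f (z + s *\<^sub>R e)) (at s)"
      unfolding u_def
      by (intro DERIV_diff partial_has_real_derivative 1 2)
  qed (use h in auto)
  then obtain s where s: "0 < s" "s < h" and
    us: "u h - u 0 = h * (partial e f (z + h *\<^sub>R d + s *\<^sub>R e) - partial e f (z + s *\<^sub>R e))" by auto
  have "\<exists>t. 0 < t \<and> t < h \<and>
     partial e f (z + s *\<^sub>R e + h *\<^sub>R d) - partial e f (z + s *\<^sub>R e + 0 *\<^sub>R d) = (h - 0) *
     partial d (partial e f) (z + s *\<^sub>R e + t *\<^sub>R d)"
  proof (rule MVT2)
    fix t assume t: "0 \<le> t" "t \<le> h"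
    show "((\<lambda>t. partial e f (z + s *\<^sub>R e + t *\<^sub>R d)) has_real_derivative
        partial d (partial e f) (z + s *\<^sub>R e + t *\<^sub>R d)) (at t)"
      by (intro partial_has_real_derivative fe inball) (use s t in auto)
  qed (use h in auto)
  then obtain t where t: "0 < t" "t < h" and
    ut: "partial e f (z + s *\<^sub>R e + h *\<^sub>R d) - partial e f (z + s *\<^sub>R e)
      = h * partial d (partial e f) (z + s *\<^sub>R e + t *\<^sub>R d)" by auto
  have "f (z + h *\<^sub>R e + h *\<^sub>R d) - f (z + h *\<^sub>R e) - f (z + h *\<^sub>R d) + f z = u h - u 0"
    by (simp add: u_def swap[of "h *\<^sub>R d"])
  also have "\<dots> = h * h * partial d (partial e f) (z + s *\<^sub>R e + t *\<^sub>R d)"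
    using us ut by (simp add: swap[of "h *\<^sub>R d"])
  finally show ?thesis using near[of s t] s t by auto
qed

lemma partial_commute:
  fixes f :: "'b::real_normed_vector \<Rightarrow> real"
  assumes S: "open S" "z \<in> S" and f: "Ck_on 2 f S"
  shows "partial e (partial d f) z = partial d (partial e f) z"
proof (rule ccontr)
  assume ne: "partial e (partial d f) z \<noteq> partial d (partial e f) z"
  have f2: "Ck_on (Suc (Suc 0)) f S" using f by (simp add: numeral_2_eq_2)
  have d0: "f differentiable (at w)" if "w \<in> S" for w using f2 that by simp
  have C1: "Ck_on (Suc 0) (partial a f) S" for a by (rule Ck_on_partial[OF S(1) f2])
  then have d1: "partial a f differentiable (at w)" if "w \<in> S" for w a using that by simp
  have c2: "continuous (at z) (partial b (partial a f))" for a b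
    using Ck_on_partial[OF S(1) C1] S by (simp add: continuous_on_eq_continuous_at)
  define \<epsilon> where "\<epsilon> = \<bar>partial e (partial d f) z - partial d (partial e f) z\<bar> / 2"
  have \<epsilon>: "\<epsilon> > 0" using ne by (simp add: \<epsilon>_def)
  obtain r where r: "r > 0" "ball z r \<subseteq> S" using S openE by blast
  obtain a where a: "a > 0"
    "\<And>w. dist w z < a \<Longrightarrow> dist (partial e (partial d f) w) (partial e (partial d f) z) < \<epsilon>"
    using c2[of e d] \<epsilon> unfolding continuous_at_eps_delta by metis
  obtain b where b: "b > 0"
    "\<And>w. dist w z < b \<Longrightarrow> dist (partial d (partial e f) w) (partial d (partial e f) z) < \<epsilon>"
    using c2[of d e] \<epsilon> unfolding continuous_at_eps_delta by metis
  define q where "q = min r (min a b)"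
  define h where "h = q / (2 * (norm e + norm d + 1))"
  have q: "q > 0" using r a b by (simp add: q_def)
  have n: "norm e + norm d + 1 > 0" by (simp add: add_nonneg_pos)
  have h: "h > 0" using q n by (simp add: h_def)
  have "h * (norm e + norm d) \<le> h * (norm e + norm d + 1)" using h by simp
  also have "\<dots> = q / 2" using n by (simp add: h_def field_simps)
  finally have hq: "h * (norm e + norm d) < q" using q by linarith
  then have hr: "h * (norm e + norm d) < r" "h * (norm d + norm e) < r"
    by (auto simp: q_def add.commute)
  obtain w where w: "dist z w \<le> h * (norm e + norm d)" and
    wh: "f (z + h *\<^sub>R e + h *\<^sub>R d) - f (z + h *\<^sub>R e) - f (z + h *\<^sub>R d) + f z
      = h * h * partial d (partial e f) w"
    using second_difference_mean_value[of z r f e h d] d0 d1 r h hr by blast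
  obtain w' where w': "dist z w' \<le> h * (norm d + norm e)" and
    wh': "f (z + h *\<^sub>R d + h *\<^sub>R e) - f (z + h *\<^sub>R d) - f (z + h *\<^sub>R e) + f z
      = h * h * partial e (partial d f) w'"
    using second_difference_mean_value[of z r f d h e] d0 d1 r h hr by blast
  have "z + h *\<^sub>R d + h *\<^sub>R e = z + h *\<^sub>R e + h *\<^sub>R d" by (simp add: algebra_simps)
  then have "h * h * partial d (partial e f) w = h * h * partial e (partial d f) w'"
    using wh wh' by (simp add: algebra_simps)
  then have eq: "partial d (partial e f) w = partial e (partial d f) w'" using h by simp
  have "dist w' z < a" "dist w z < b"
    using w w' hq by (auto simp: q_def dist_commute add.commute)
  then have "\<bar>partial e (partial d f) w' - partial e (partial d f) z\<bar> < \<epsilon>"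
    "\<bar>partial d (partial e f) w - partial d (partial e f) z\<bar> < \<epsilon>"
    using a(2) b(2) by (auto simp: dist_real_def)
  note near = this[unfolded eq]
  have "\<bar>p - q\<bar> \<le> \<bar>x - p\<bar> + \<bar>x - q\<bar>" for p q x :: real by linarith
  then have "\<bar>partial e (partial d f) z - partial d (partial e f) z\<bar> < \<epsilon> + \<epsilon>"
    by (rule order.strict_trans1) (rule add_strict_mono[OF near])
  then show False by (simp add: \<epsilon>_def)
qed

section \<open>Smooth functions\<close>

lemma smooth_on_const: "open S \<Longrightarrow> smooth_on S (\<lambda>x. c)"
  by (simp add: smooth_on_def Ck_on_const)

lemma smooth_on_bounded_linear: "open S \<Longrightarrow> bounded_linear f \<Longrightarrow> smooth_on S f"
  by (simp add: smooth_on_def Ck_on_bounded_linear)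

lemma smooth_on_cong:
  "open S \<Longrightarrow> (\<And>x. x \<in> S \<Longrightarrow> f x = g x) \<Longrightarrow> smooth_on S f \<Longrightarrow> smooth_on S g"
  unfolding smooth_on_def using Ck_on_cong by blast

context
  fixes S :: "'b::real_normed_vector set"
  assumes S: "open S"
begin

lemma smooth_on_add:
  fixes f g :: "'b \<Rightarrow> real"
  shows "smooth_on S f \<Longrightarrow> smooth_on S g \<Longrightarrow> smooth_on S (\<lambda>x. f x + g x)"
  by (simp add: smooth_on_def Ck_on_add S)

lemma smooth_on_mult:
  fixes f g :: "'b \<Rightarrow> real"
  shows "smooth_on S f \<Longrightarrow> smooth_on S g \<Longrightarrow> smooth_on S (\<lambda>x. f x * g x)"
  by (simp add: smooth_on_def Ck_on_mult S)

lemma smooth_on_cmult: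
  fixes f :: "'b \<Rightarrow> real"
  shows "smooth_on S f \<Longrightarrow> smooth_on S (\<lambda>x. c * f x)"
  by (intro smooth_on_mult smooth_on_const S)

lemma smooth_on_diff:
  fixes f g :: "'b \<Rightarrow> real"
  assumes "smooth_on S f" "smooth_on S g"
  shows "smooth_on S (\<lambda>x. f x - g x)"
  using smooth_on_add[OF assms(1) smooth_on_cmult[OF assms(2), of "-1"]] by simp

lemma smooth_on_sum:
  fixes f :: "'i \<Rightarrow> 'b \<Rightarrow> real"
  shows "(\<And>i. i \<in> I \<Longrightarrow> smooth_on S (f i)) \<Longrightarrow> smooth_on S (\<lambda>x. \<Sum>i\<in>I. f i x)"
  by (induction I rule: infinite_finite_induct) (auto intro: smooth_on_const smooth_on_add S)

lemma smooth_on_prod: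
  fixes f :: "'i \<Rightarrow> 'b \<Rightarrow> real"
  shows "(\<And>i. i \<in> I \<Longrightarrow> smooth_on S (f i)) \<Longrightarrow> smooth_on S (\<lambda>x. \<Prod>i\<in>I. f i x)"
  by (induction I rule: infinite_finite_induct) (auto intro: smooth_on_const smooth_on_mult S)

lemma smooth_on_divide:
  fixes f g :: "'b \<Rightarrow> real"
  assumes "smooth_on S f" "smooth_on S g" "\<And>x. x \<in> S \<Longrightarrow> g x \<noteq> 0"
  shows "smooth_on S (\<lambda>x. f x / g x)"
  using assms by (auto simp: divide_inverse smooth_on_def intro!: Ck_on_mult Ck_on_inverse S)

lemma smooth_on_partial:
  fixes f :: "'b \<Rightarrow> real"
  shows "smooth_on S f \<Longrightarrow> smooth_on S (partial e f)"
  unfolding smooth_on_def using Ck_on_partial[OF S] by blast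

lemma smooth_on_partial_commute:
  fixes f :: "'b \<Rightarrow> real"
  shows "smooth_on S f \<Longrightarrow> z \<in> S \<Longrightarrow> partial e (partial d f) z = partial d (partial e f) z"
  unfolding smooth_on_def using partial_commute[OF S] by blast

lemma smooth_on_det:
  fixes B :: "'b \<Rightarrow> real^'n^'n"
  assumes "\<And>i j. smooth_on S (\<lambda>x. B x $ i $ j)"
  shows "smooth_on S (\<lambda>x. det (B x))"
  unfolding det_def by (intro smooth_on_sum smooth_on_cmult smooth_on_prod assms)

end

lemma smooth_on_differentiable:
  assumes "smooth_on S f" "x \<in> S" shows "f differentiable (at x)"
proof -
  have "Ck_on (Suc 0) f S" using assms(1) unfolding smooth_on_def by blast
  then show ?thesis using assms(2) by simp
qed

lemma partial_const: "partial e (\<lambda>x. c) z = 0"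
  by (simp add: partial_def)

lemma partial_diff:
  fixes f g :: "'b::real_normed_vector \<Rightarrow> real"
  assumes "f differentiable (at z)" "g differentiable (at z)"
  shows "partial e (\<lambda>x. f x - g x) z = partial e f z - partial e g z"
  unfolding partial_def[of e "\<lambda>x. f x - g x"]
  using partial_has_real_derivative[of f z 0 e] partial_has_real_derivative[of g z 0 e] assms
  by (auto intro!: DERIV_imp_deriv DERIV_diff)

lemma partial_add:
  fixes f g :: "'b::real_normed_vector \<Rightarrow> real"
  assumes "f differentiable (at z)" "g differentiable (at z)"
  shows "partial e (\<lambda>x. f x + g x) z = partial e f z + partial e g z"
  unfolding partial_def[of e "\<lambda>x. f x + g x"]
  using partial_has_real_derivative[of f z 0 e] partial_has_real_derivative[of g z 0 e] assms
  by (auto intro!: DERIV_imp_deriv DERIV_add)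

lemma partial_mult:
  fixes f g :: "'b::real_normed_vector \<Rightarrow> real"
  assumes "f differentiable (at z)" "g differentiable (at z)"
  shows "partial e (\<lambda>x. f x * g x) z = partial e f z * g z + f z * partial e g z"
proof -
  have "((\<lambda>t. f (z + t *\<^sub>R e) * g (z + t *\<^sub>R e)) has_real_derivative
     partial e f z * g z + f z * partial e g z) (at 0)"
    using DERIV_mult[OF partial_has_real_derivative[of f z 0 e] partial_has_real_derivative[of g z 0 e]]
      assms by (simp add: algebra_simps)
  then show ?thesis by (simp add: partial_def[of e "\<lambda>x. f x * g x"] DERIV_imp_deriv)
qed

lemma partial_cmult:
  fixes f :: "'b::real_normed_vector \<Rightarrow> real"
  assumes "f differentiable (at z)"
  shows "partial e (\<lambda>x. c * f x) z = c * partial e f z"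
  using partial_mult[of "\<lambda>_. c" z f e] assms by (simp add: partial_const)

lemma partial_sum:
  fixes f :: "'i \<Rightarrow> 'b::real_normed_vector \<Rightarrow> real"
  assumes "\<And>i. i \<in> I \<Longrightarrow> f i differentiable (at z)"
  shows "partial e (\<lambda>x. \<Sum>i\<in>I. f i x) z = (\<Sum>i\<in>I. partial e (f i) z)"
proof -
  have "((\<lambda>t. \<Sum>i\<in>I. f i (z + t *\<^sub>R e)) has_real_derivative (\<Sum>i\<in>I. partial e (f i) z)) (at 0)"
    using partial_has_real_derivative[of _ z 0 e] assms by (intro DERIV_sum) auto
  then show ?thesis by (simp add: partial_def[of e "\<lambda>x. \<Sum>i\<in>I. f i x"] DERIV_imp_deriv)
qed

lemma smooth_on_fibre_coordinate:
  fixes S :: "((real^'n) \<times> (real^'n)) set"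
  shows "open S \<Longrightarrow> smooth_on S (\<lambda>z. snd z $ j)"
  by (rule smooth_on_bounded_linear)
    (auto intro: bounded_linear_compose[OF bounded_linear_vec_nth] bounded_linear_snd)

section \<open>Smoothness of the spray\<close>

lemma matrix_inv_component:
  fixes B :: "real^'n^'n"
  assumes "det B \<noteq> 0"
  shows "matrix_inv B $ i $ h =
    det (\<chi> a b. if b = i then axis h 1 $ a else B $ a $ b) / det B"
proof -
  have inv: "B ** matrix_inv B = mat 1"
    using assms someI_ex[of "\<lambda>A'. B ** A' = mat 1 \<and> A' ** B = mat 1"]
    by (auto simp: matrix_inv_def invertible_def simp flip: invertible_det_nz)
  have "B *v (matrix_inv B *v axis h 1) = axis h 1"
    by (simp add: matrix_vector_mul_assoc inv)
  then have "matrix_inv B *v axis h 1 =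
      (\<chi> k. det (\<chi> a b. if b = k then axis h 1 $ a else B $ a $ b) / det B)"
    using cramer[OF assms] by blast
  moreover have "(matrix_inv B *v axis h 1) $ i = matrix_inv B $ i $ h"
    by (simp add: matrix_vector_mult_basis column_def)
  ultimately show ?thesis by simp
qed

lemma det_nonzero_if_positive_definite:
  fixes B :: "real^'n^'n"
  assumes "\<And>w. w \<noteq> 0 \<Longrightarrow> (\<Sum>i\<in>UNIV. \<Sum>j\<in>UNIV. B $ i $ j * w $ i * w $ j) > 0"
  shows "det B \<noteq> 0"
proof
  assume "det B = 0"
  then have "\<not> invertible B" by (simp add: invertible_det_nz)
  then obtain w where w: "w \<noteq> 0" "B *v w = 0"
    using matrix_left_invertible_ker[of B] invertible_left_inverse[of B] by auto
  have "(\<Sum>i\<in>UNIV. \<Sum>j\<in>UNIV. B $ i $ j * w $ i * w $ j) = (\<Sum>i\<in>UNIV. w $ i * (B *v w) $ i)"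
    by (simp add: matrix_vector_mult_def sum_distrib_left mult_ac)
  then show False using assms[OF w(1)] w(2) by simp
qed

text \<open>The only entries of the spray that are not visibly smooth are those of the inverse of the fundamental
  tensor. They are quotients of determinants whose denominator does not vanish, by positive
  definiteness.\<close>

lemma smooth_on_spray:
  fixes L :: "(real^'n::finite) \<times> (real^'n) \<Rightarrow> real"
  assumes S: "open S" and L: "smooth_on S L"
    and pos: "\<And>z w. z \<in> S \<Longrightarrow> w \<noteq> 0 \<Longrightarrow>
      (\<Sum>i\<in>UNIV. \<Sum>j\<in>UNIV. fund_tensor L i j z * w $ i * w $ j) > 0"
  shows "smooth_on S (spray L i)"
proof -
  have L2: "smooth_on S (\<lambda>w. (L w)\<^sup>2)"
    unfolding power2_eq_square by (intro smooth_on_mult S L)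
  have g: "smooth_on S (fund_tensor L a b)" for a b
    unfolding fund_tensor_def[abs_def] by (intro smooth_on_cmult smooth_on_partial S L2)
  have nz: "det (\<chi> a b. fund_tensor L a b z) \<noteq> 0" if "z \<in> S" for z
    by (rule det_nonzero_if_positive_definite) (use pos[OF that] in simp)
  have "smooth_on S (\<lambda>z. det (\<chi> a b. if b = i then axis h 1 $ a else fund_tensor L a b z) /
      det (\<chi> a b. fund_tensor L a b z))" for h
  proof (intro smooth_on_divide smooth_on_det S nz)
    show "smooth_on S (\<lambda>x. (\<chi> a b. if b = i then axis h 1 $ a else fund_tensor L a b x) $ k $ j)" for k j
      by (cases "j = i") (simp_all add: smooth_on_const S g)
  qed (simp_all add: g)
  then have "smooth_on S (fund_tensor_inv L i h)" for h
    using smooth_on_cong[OF S, of "\<lambda>z. det (\<chi> a b. if b = i then axis h 1 $ a else fund_tensor L a b z) /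
      det (\<chi> a b. fund_tensor L a b z)" "fund_tensor_inv L i h"]
    by (simp add: fund_tensor_inv_def matrix_inv_component nz cong: if_cong)
  then show ?thesis
    unfolding spray_def[abs_def]
    by (intro smooth_on_cmult smooth_on_sum smooth_on_mult smooth_on_diff smooth_on_partial
        smooth_on_fibre_coordinate S L2)
qed

section \<open>The antisymmetric part of the Ricci curvature of a spray\<close>

lemma partial_fibre_coordinate:
  "partial (a, b) (\<lambda>z :: (real^'n::finite) \<times> (real^'n). snd z $ m) z = b $ m"
proof -
  have "((\<lambda>t. snd (z + t *\<^sub>R (a, b)) $ m) has_real_derivative b $ m) (at 0)"
    by (auto intro!: derivative_eq_intros)
  then show ?thesis unfolding partial_def by (rule DERIV_imp_deriv)
qed

context
  fixes L :: "(real^'n::finite) \<times> (real^'n) \<Rightarrow> real" and S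
  assumes S: "open S" and G: "\<And>i. smooth_on S (spray L i)"
begin

text \<open>The terms are arranged so that those containing three derivatives of \<open>G\<^sup>i\<close>, or two vertical derivatives of
  \<open>G\<^sup>m\<close> as a factor, are symmetric in \<open>k\<close> and \<open>l\<close> up to the order of differentiation.\<close>

lemma pdy_riem:
  assumes z: "z \<in> S"
  shows "pdy l (riem L i k) z =
      2 * pdx k (pdy l (spray L i)) z - pdx l (pdy k (spray L i)) z
      - (\<Sum>m\<in>UNIV. snd z $ m * pdx m (pdy k (pdy l (spray L i))) z)
      + 2 * (\<Sum>m\<in>UNIV. pdy l (spray L m) z * pdy m (pdy k (spray L i)) z)
      + 2 * (\<Sum>m\<in>UNIV. spray L m z * pdy m (pdy k (pdy l (spray L i))) z)
      - (\<Sum>m\<in>UNIV. pdy k (spray L m) z * pdy m (pdy l (spray L i)) z)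
      - (\<Sum>m\<in>UNIV. pdy m (spray L i) z * pdy k (pdy l (spray L m)) z)"
proof -
  note sm = smooth_on_cmult[OF S] smooth_on_sum[OF S] smooth_on_mult[OF S] smooth_on_diff[OF S]
    smooth_on_add[OF S] smooth_on_partial[OF S] smooth_on_fibre_coordinate[OF S] G
  have d: "f differentiable (at z)" if "smooth_on S f" for f :: "(real^'n) \<times> (real^'n) \<Rightarrow> real"
    using smooth_on_differentiable[OF that z] .
  have com: "partial a (partial b f) z = partial b (partial a f) z"
    if "smooth_on S f" for a b and f :: "(real^'n) \<times> (real^'n) \<Rightarrow> real"
    by (rule smooth_on_partial_commute[OF S that z])
  have com2: "partial a (partial b (partial c f)) z = partial a (partial c (partial b f)) z"
    if "smooth_on S f" for a b c and f :: "(real^'n) \<times> (real^'n) \<Rightarrow> real"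
    by (rule partial_cong_open[OF S z]) (rule smooth_on_partial_commute[OF S that])
  have 1: "pdy l (\<lambda>z. 2 * pdx k (spray L i) z) z = 2 * pdx k (pdy l (spray L i)) z"
    by (subst partial_cmult, intro d sm, subst com, intro sm, rule refl)
  have "pdy l (\<lambda>z. \<Sum>m\<in>UNIV. snd z $ m * pdx m (pdy k (spray L i)) z) z
     = (\<Sum>m\<in>UNIV. (if m = l then pdx m (pdy k (spray L i)) z else 0)
         + snd z $ m * pdx m (pdy k (pdy l (spray L i))) z)"
  proof (subst partial_sum, intro d sm, intro sum.cong refl)
    fix m
    have "pdy l (pdx m (pdy k (spray L i))) z = pdx m (pdy k (pdy l (spray L i))) z"
      using com[of "pdy k (spray L i)" "(0, axis l 1)" "(axis m 1, 0)"]
        com2[of "spray L i" "(axis m 1, 0)" "(0, axis l 1)" "(0, axis k 1)"]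
      by (simp add: sm)
    moreover have "axis l 1 $ m = (if m = l then 1 else (0::real))" by (simp add: axis_def)
    ultimately show "pdy l (\<lambda>z. snd z $ m * pdx m (pdy k (spray L i)) z) z =
       (if m = l then pdx m (pdy k (spray L i)) z else 0)
         + snd z $ m * pdx m (pdy k (pdy l (spray L i))) z"
      by (subst partial_mult, intro d sm, intro d sm) (simp add: partial_fibre_coordinate)
  qed
  then have 2: "pdy l (\<lambda>z. \<Sum>m\<in>UNIV. snd z $ m * pdx m (pdy k (spray L i)) z) z
     = pdx l (pdy k (spray L i)) z + (\<Sum>m\<in>UNIV. snd z $ m * pdx m (pdy k (pdy l (spray L i))) z)"
    by (simp add: sum.distrib)
  have "pdy l (\<lambda>z. \<Sum>m\<in>UNIV. spray L m z * pdy m (pdy k (spray L i)) z) z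
     = (\<Sum>m\<in>UNIV. pdy l (spray L m) z * pdy m (pdy k (spray L i)) z
         + spray L m z * pdy m (pdy k (pdy l (spray L i))) z)"
  proof (subst partial_sum, intro d sm, intro sum.cong refl)
    fix m
    have "pdy l (pdy m (pdy k (spray L i))) z = pdy m (pdy k (pdy l (spray L i))) z"
      using com[of "pdy k (spray L i)" "(0, axis l 1)" "(0, axis m 1)"]
        com2[of "spray L i" "(0, axis m 1)" "(0, axis l 1)" "(0, axis k 1)"]
      by (simp add: sm)
    then show "pdy l (\<lambda>z. spray L m z * pdy m (pdy k (spray L i)) z) z =
       pdy l (spray L m) z * pdy m (pdy k (spray L i)) z
         + spray L m z * pdy m (pdy k (pdy l (spray L i))) z"
      by (subst partial_mult, intro d sm, intro d sm) simp
  qed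
  then have 3: "pdy l (\<lambda>z. 2 * (\<Sum>m\<in>UNIV. spray L m z * pdy m (pdy k (spray L i)) z)) z
     = 2 * (\<Sum>m\<in>UNIV. pdy l (spray L m) z * pdy m (pdy k (spray L i)) z)
      + 2 * (\<Sum>m\<in>UNIV. spray L m z * pdy m (pdy k (pdy l (spray L i))) z)"
    by (subst partial_cmult, intro d sm) (simp add: sum.distrib)
  have "pdy l (\<lambda>z. \<Sum>m\<in>UNIV. pdy m (spray L i) z * pdy k (spray L m) z) z
     = (\<Sum>m\<in>UNIV. pdy k (spray L m) z * pdy m (pdy l (spray L i)) z
         + pdy m (spray L i) z * pdy k (pdy l (spray L m)) z)"
  proof (subst partial_sum, intro d sm, intro sum.cong refl)
    fix m
    show "pdy l (\<lambda>z. pdy m (spray L i) z * pdy k (spray L m) z) z =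
       pdy k (spray L m) z * pdy m (pdy l (spray L i)) z
         + pdy m (spray L i) z * pdy k (pdy l (spray L m)) z"
      using com[OF G, of "(0, axis l 1)" "(0, axis m 1)" i] com[OF G, of "(0, axis l 1)" "(0, axis k 1)" m]
      by (subst partial_mult, intro d sm, intro d sm) simp
  qed
  then have 4: "pdy l (\<lambda>z. \<Sum>m\<in>UNIV. pdy m (spray L i) z * pdy k (spray L m) z) z
     = (\<Sum>m\<in>UNIV. pdy k (spray L m) z * pdy m (pdy l (spray L i)) z)
      + (\<Sum>m\<in>UNIV. pdy m (spray L i) z * pdy k (pdy l (spray L m)) z)"
    by (simp add: sum.distrib)
  show ?thesis
    unfolding riem_def[abs_def]
    by (subst partial_diff, intro d sm, intro d sm, subst partial_add, intro d sm, intro d sm,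
        subst partial_diff, intro d sm, intro d sm) (simp add: 1 2 3 4)
qed

lemma smooth_on_riem: "smooth_on S (riem L i k)"
  unfolding riem_def[abs_def]
  by (intro smooth_on_cmult[OF S] smooth_on_sum[OF S] smooth_on_mult[OF S] smooth_on_diff[OF S]
    smooth_on_add[OF S] smooth_on_partial[OF S] smooth_on_fibre_coordinate[OF S] G)

lemma pdy_riem_antisym:
  assumes z: "z \<in> S"
  shows "pdy l (riem L i k) z - pdy k (riem L i l) z =
      3 * (pdx k (pdy l (spray L i)) z - pdx l (pdy k (spray L i)) z
        + (\<Sum>m\<in>UNIV. pdy l (spray L m) z * pdy m (pdy k (spray L i)) z)
        - (\<Sum>m\<in>UNIV. pdy k (spray L m) z * pdy m (pdy l (spray L i)) z))"
proof -
  have com: "partial a (partial b f) z = partial b (partial a f) z"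
    if "smooth_on S f" for a b and f :: "(real^'n) \<times> (real^'n) \<Rightarrow> real"
    by (rule smooth_on_partial_commute[OF S that z])
  have com2: "partial a (partial b (partial c f)) z = partial a (partial c (partial b f)) z"
    if "smooth_on S f" for a b c and f :: "(real^'n) \<times> (real^'n) \<Rightarrow> real"
    by (rule partial_cong_open[OF S z]) (rule smooth_on_partial_commute[OF S that])
  have "pdx m (pdy k (pdy l (spray L i))) z = pdx m (pdy l (pdy k (spray L i))) z"
    "pdy m (pdy k (pdy l (spray L i))) z = pdy m (pdy l (pdy k (spray L i))) z"
    "pdy k (pdy l (spray L m)) z = pdy l (pdy k (spray L m)) z" for m
    by (rule com2[OF G] com[OF G])+
  then show ?thesis unfolding pdy_riem[OF z] by simp
qed

text \<open>The part \<open>R\<^sup>i\<^sub>i\<^sub>.\<^sub>l\<^sub>.\<^sub>j\<close> of \<open>K\<^sub>j\<^sub>l\<close> is symmetric and drops out. In the rest the derivative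
  \<open>\<partial>/\<partial>y\<^sup>i\<close> is moved to the outside, where it meets the antisymmetrised
  \<open>R\<^sup>i\<^sub>j\<^sub>.\<^sub>l - R\<^sup>i\<^sub>l\<^sub>.\<^sub>j\<close>.\<close>

lemma R_antisym_eq:
  assumes z: "z \<in> S"
  defines "N \<equiv> \<lambda>z. \<Sum>m\<in>UNIV. spray1 L m m z"
  shows "R_antisym L j l z = 1/2 * (hor_deriv L j (pdy l N) z - hor_deriv L l (pdy j N) z)"
proof -
  note sm = smooth_on_cmult[OF S] smooth_on_sum[OF S] smooth_on_mult[OF S] smooth_on_diff[OF S]
    smooth_on_add[OF S] smooth_on_partial[OF S] G
  have d: "f differentiable (at z)" if "smooth_on S f" for f :: "(real^'n) \<times> (real^'n) \<Rightarrow> real"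
    using smooth_on_differentiable[OF that z] .
  have com: "partial a (partial b f) z = partial b (partial a f) z"
    if "smooth_on S f" for a b and f :: "(real^'n) \<times> (real^'n) \<Rightarrow> real"
    by (rule smooth_on_partial_commute[OF S that z])
  have N: "partial a (pdy b N) z = (\<Sum>i\<in>UNIV. pdy i (partial a (pdy b (spray L i))) z)" for a b
  proof -
    have "partial a (pdy b N) z = partial a (\<lambda>w. \<Sum>i\<in>UNIV. pdy i (pdy b (spray L i)) w) z"
    proof (rule partial_cong_open[OF S z])
      fix w assume w: "w \<in> S"
      have "pdy b N w = (\<Sum>i\<in>UNIV. pdy b (pdy i (spray L i)) w)"
        unfolding N_def spray1_def
        by (rule partial_sum) (intro smooth_on_differentiable[OF _ w] sm)
      also have "\<dots> = (\<Sum>i\<in>UNIV. pdy i (pdy b (spray L i)) w)"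
        by (intro sum.cong refl smooth_on_partial_commute[OF S G w])
      finally show "pdy b N w = (\<Sum>i\<in>UNIV. pdy i (pdy b (spray L i)) w)" .
    qed
    also have "\<dots> = (\<Sum>i\<in>UNIV. partial a (pdy i (pdy b (spray L i))) z)"
      by (subst partial_sum, intro d sm) simp
    also have "\<dots> = (\<Sum>i\<in>UNIV. pdy i (partial a (pdy b (spray L i))) z)"
      by (intro sum.cong refl com sm)
    finally show ?thesis .
  qed
  have quad: "(\<Sum>i\<in>UNIV. pdy i (\<lambda>w. \<Sum>m\<in>UNIV. pdy a (spray L m) w * pdy m (pdy b (spray L i)) w) z)
     = (\<Sum>i\<in>UNIV. \<Sum>m\<in>UNIV. pdy i (pdy a (spray L m)) z * pdy m (pdy b (spray L i)) z)
      + (\<Sum>m\<in>UNIV. spray1 L m a z * pdy m (pdy b N) z)" for a b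
  proof -
    have "pdy i (\<lambda>w. \<Sum>m\<in>UNIV. pdy a (spray L m) w * pdy m (pdy b (spray L i)) w) z
       = (\<Sum>m\<in>UNIV. pdy i (pdy a (spray L m)) z * pdy m (pdy b (spray L i)) z
           + pdy a (spray L m) z * pdy i (pdy m (pdy b (spray L i))) z)" for i
      by (subst partial_sum, intro d sm, intro sum.cong refl partial_mult d sm)
    then have "(\<Sum>i\<in>UNIV. pdy i (\<lambda>w. \<Sum>m\<in>UNIV. pdy a (spray L m) w * pdy m (pdy b (spray L i)) w) z)
      = (\<Sum>i\<in>UNIV. \<Sum>m\<in>UNIV. pdy i (pdy a (spray L m)) z * pdy m (pdy b (spray L i)) z)
      + (\<Sum>i\<in>UNIV. \<Sum>m\<in>UNIV. pdy a (spray L m) z * pdy i (pdy m (pdy b (spray L i))) z)"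
      by (simp add: sum.distrib)
    also have "(\<Sum>i\<in>UNIV. \<Sum>m\<in>UNIV. pdy a (spray L m) z * pdy i (pdy m (pdy b (spray L i))) z)
      = (\<Sum>m\<in>UNIV. spray1 L m a z * pdy m (pdy b N) z)"
      by (subst sum.swap) (simp add: N spray1_def sum_distrib_left)
    finally show ?thesis .
  qed
  \<comment> \<open>Exchanging the two summation indices shows that the terms quadratic in \<open>G\<^sup>i\<^sub>j\<^sub>k\<close> are symmetric in \<open>j\<close> and \<open>l\<close>.\<close>
  have swap: "(\<Sum>i\<in>UNIV. \<Sum>m\<in>UNIV. pdy i (pdy l (spray L m)) z * pdy m (pdy j (spray L i)) z)
     = (\<Sum>i\<in>UNIV. \<Sum>m\<in>UNIV. pdy i (pdy j (spray L m)) z * pdy m (pdy l (spray L i)) z)"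
    by (subst sum.swap) (simp add: mult.commute)
  have "K_ricci L j l z - K_ricci L l j z
     = (\<Sum>i\<in>UNIV. 1/3 * (pdy l (pdy i (riem L i j)) z - pdy j (pdy i (riem L i l)) z))"
    unfolding K_ricci_def K_curv_def
    using com[OF smooth_on_riem] by (simp add: sum_subtractf[symmetric] algebra_simps)
  also have "\<dots> = (\<Sum>i\<in>UNIV. pdy i (\<lambda>w. 1/3 * (pdy l (riem L i j) w - pdy j (riem L i l) w)) z)"
  proof (intro sum.cong refl)
    fix i
    have "pdy i (\<lambda>w. 1/3 * (pdy l (riem L i j) w - pdy j (riem L i l) w)) z
      = 1/3 * (pdy i (pdy l (riem L i j)) z - pdy i (pdy j (riem L i l)) z)"
      by (subst partial_cmult, intro d sm smooth_on_riem, subst partial_diff)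
        (intro d sm smooth_on_riem refl)+
    then show "1/3 * (pdy l (pdy i (riem L i j)) z - pdy j (pdy i (riem L i l)) z) =
        pdy i (\<lambda>w. 1/3 * (pdy l (riem L i j) w - pdy j (riem L i l) w)) z"
      using com[OF smooth_on_riem, of "(0, axis l 1)" "(0, axis i 1)" i j]
        com[OF smooth_on_riem, of "(0, axis j 1)" "(0, axis i 1)" i l] by simp
  qed
  also have "\<dots> = (\<Sum>i\<in>UNIV. pdy i (\<lambda>w. pdx j (pdy l (spray L i)) w - pdx l (pdy j (spray L i)) w
        + (\<Sum>m\<in>UNIV. pdy l (spray L m) w * pdy m (pdy j (spray L i)) w)
        - (\<Sum>m\<in>UNIV. pdy j (spray L m) w * pdy m (pdy l (spray L i)) w)) z)"
    by (intro sum.cong refl partial_cong_open[OF S z]) (simp add: pdy_riem_antisym)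
  also have "\<dots> = (\<Sum>i\<in>UNIV. pdy i (pdx j (pdy l (spray L i))) z - pdy i (pdx l (pdy j (spray L i))) z
        + pdy i (\<lambda>w. \<Sum>m\<in>UNIV. pdy l (spray L m) w * pdy m (pdy j (spray L i)) w) z
        - pdy i (\<lambda>w. \<Sum>m\<in>UNIV. pdy j (spray L m) w * pdy m (pdy l (spray L i)) w) z)"
    by (intro sum.cong refl, subst partial_diff, intro d sm, intro d sm, subst partial_add,
        intro d sm, intro d sm, subst partial_diff) (intro d sm refl)+
  also have "\<dots> = hor_deriv L j (pdy l N) z - hor_deriv L l (pdy j N) z"
    unfolding sum.distrib sum_subtractf quad swap N[symmetric] hor_deriv_def by simp
  finally show ?thesis by (simp add: R_antisym_def)
qed

end

lemma partial_base_function: "partial (a, b) (\<lambda>z. h (fst z)) z = partial a h (fst z)"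
  by (simp add: partial_def)

text \<open>The volume term of the S-curvature is linear in \<open>y\<close>, with coefficients that depend on \<open>x\<close> alone.\<close>

lemma pdy_S_curv:
  fixes L :: "(real^'n::finite) \<times> (real^'n) \<Rightarrow> real"
  assumes "(\<lambda>z. \<Sum>m\<in>UNIV. spray1 L m m z) differentiable (at z)"
  shows "pdy r (S_curv L) z = pdy r (\<lambda>z. \<Sum>m\<in>UNIV. spray1 L m m z) z
      - pd r (\<lambda>x. ln (BH_density L x)) (fst z)"
proof -
  let ?q = "\<lambda>m. pd m (\<lambda>x. ln (BH_density L x)) (fst z)"
  let ?N = "\<lambda>z. \<Sum>m\<in>UNIV. spray1 L m m z"
  let ?e = "(0, axis r 1) :: (real^'n) \<times> (real^'n)"
  have "((\<lambda>t. \<Sum>m\<in>UNIV. (snd z $ m + t * axis r 1 $ m) * ?q m) has_real_derivative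
      (\<Sum>m\<in>UNIV. axis r 1 $ m * ?q m)) (at 0)"
    by (auto intro!: derivative_eq_intros)
  also have "(\<Sum>m\<in>UNIV. axis r 1 $ m * ?q m) = (\<Sum>m\<in>UNIV. if r = m then ?q m else 0)"
    by (intro sum.cong) (auto simp: axis_def)
  also have "\<dots> = ?q r" by simp
  finally have "((\<lambda>t. ?N (z + t *\<^sub>R ?e) - (\<Sum>m\<in>UNIV. (snd z $ m + t * axis r 1 $ m) * ?q m))
      has_real_derivative pdy r ?N z - ?q r) (at 0)"
    using partial_has_real_derivative[of ?N z 0 ?e] assms
    by (intro DERIV_diff) (simp_all flip: zero_prod_def)
  then have "((\<lambda>t. S_curv L (z + t *\<^sub>R ?e)) has_real_derivative pdy r ?N z - ?q r) (at 0)"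
    by (simp add: S_curv_def)
  then show ?thesis unfolding partial_def[of ?e "S_curv L"] by (rule DERIV_imp_deriv)
qed

lemma R_antisym_Sigma_cancel:
  fixes L :: "(real^'n::finite) \<times> (real^'n) \<Rightarrow> real"
  assumes S: "open S" and G: "\<And>i. smooth_on S (spray L i)" and z: "z \<in> S"
    and W: "open W" "fst z \<in> W" "Ck_on 2 (\<lambda>x. ln (BH_density L x)) W"
  shows "R_antisym L j l z + (real CARD('n) + 1) / 2 * Sigma_curv L j l z = 0"
proof -
  define N where "N = (\<lambda>z. \<Sum>m\<in>UNIV. spray1 L m m z)"
  define \<sigma> where "\<sigma> = (\<lambda>x. ln (BH_density L x))"
  have N: "smooth_on S N"
    unfolding N_def spray1_def by (intro smooth_on_sum smooth_on_partial S G)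
  have "Ck_on (Suc (Suc 0)) \<sigma> W" using W(3) by (simp add: numeral_2_eq_2 \<sigma>_def)
  then have "Ck_on (Suc 0) (pd l \<sigma>) W" for l by (rule Ck_on_partial[OF W(1)])
  then have d\<sigma>: "pd l \<sigma> differentiable (at (fst z))" for l using W(2) by simp
  have \<sigma>': "(\<lambda>w. pd l \<sigma> (fst w)) differentiable (at z)" for l
    using differentiable_chain_at[of fst z "pd l \<sigma>"] d\<sigma>[of l]
    by (simp add: o_def bounded_linear_imp_differentiable bounded_linear_fst)
  \<comment> \<open>The volume term does not depend on \<open>y\<close>, so only \<open>\<partial>/\<partial>x\<^sup>k\<close> acts on it.\<close>
  have hor: "hor_deriv L k (pdy i (S_curv L)) z = hor_deriv L k (pdy i N) z - pd k (pd i \<sigma>) (fst z)" for i k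
  proof -
    have e: "partial e (pdy i (S_curv L)) z = partial e (pdy i N) z - partial e (\<lambda>w. pd i \<sigma> (fst w)) z" for e
    proof -
      have "partial e (pdy i (S_curv L)) z = partial e (\<lambda>w. pdy i N w - pd i \<sigma> (fst w)) z"
        unfolding N_def \<sigma>_def
        by (rule partial_cong_open[OF S z], rule pdy_S_curv)
          (use smooth_on_differentiable[OF N] in \<open>simp add: N_def\<close>)
      also have "\<dots> = partial e (pdy i N) z - partial e (\<lambda>w. pd i \<sigma> (fst w)) z"
        by (intro partial_diff \<sigma>' smooth_on_differentiable[OF _ z] smooth_on_partial S N)
      finally show ?thesis .
    qed
    have "partial 0 (pd i \<sigma>) (fst z) = 0" by (simp add: partial_def)
    then show ?thesis
      by (simp add: hor_deriv_def e partial_base_function)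
  qed
  have sym: "pd l (pd j \<sigma>) (fst z) = pd j (pd l \<sigma>) (fst z)"
    by (rule partial_commute[OF W(1,2)]) (use W(3) in \<open>simp add: \<sigma>_def\<close>)
  have G2: "spray2 L r j l z = spray2 L r l j z" for r
    unfolding spray2_def spray1_def by (rule smooth_on_partial_commute[OF S G z])
  show ?thesis
    unfolding R_antisym_eq[OF S G z] Sigma_curv_def berwald_hcov_def hor N_def[symmetric]
    by (simp add: G2 sym field_simps)
qed

section \<open>Volumes of unit balls of homogeneous functions\<close>

lemma homogeneous_sublevel_volume:
  fixes f :: "'a::euclidean_space \<Rightarrow> real"
  assumes hom: "\<And>t y. t > 0 \<Longrightarrow> f (t *\<^sub>R y) = t * f y" and r: "r > 0"
  shows "emeasure lebesgue {y. f y < r} = ennreal (r ^ DIM('a)) * emeasure lebesgue {y. f y < 1}"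
proof -
  have "{y. f y < r} = (\<lambda>y. r *\<^sub>R y + 0) ` {y. f y < 1}"
  proof (intro equalityI subsetI)
    fix y assume "y \<in> {y. f y < r}"
    then have "f (inverse r *\<^sub>R y) < 1" using r by (simp add: hom field_simps)
    moreover have "y = r *\<^sub>R (inverse r *\<^sub>R y) + 0" using r by simp
    ultimately show "y \<in> (\<lambda>y. r *\<^sub>R y + 0) ` {y. f y < 1}" by blast
  qed (use r in \<open>auto simp: hom\<close>)
  then show ?thesis
    using r by (simp add: emeasure_lebesgue_affine del: add_0_right)
qed

text \<open>A homogeneous function pushes Lebesgue measure forward to a measure whose value on \<open>{..<r}\<close> is \<open>r\<^sup>n\<close>
  times its unit ball volume. Two such measures are therefore proportional, since the half-lines
  generate the Borel sets.\<close>

lemma homogeneous_distr_proportional: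
  fixes f g :: "'a::euclidean_space \<Rightarrow> real"
  assumes f: "f \<in> borel_measurable borel" "\<And>y. 0 \<le> f y" "\<And>t y. t > 0 \<Longrightarrow> f (t *\<^sub>R y) = t * f y"
    and g: "g \<in> borel_measurable borel" "\<And>y. 0 \<le> g y" "\<And>t y. t > 0 \<Longrightarrow> g (t *\<^sub>R y) = t * g y"
    and fin: "emeasure lebesgue {y. f y < 1} < \<infinity>" "emeasure lebesgue {y. g y < 1} < \<infinity>"
  shows "scale_measure (emeasure lebesgue {y. g y < 1}) (distr lebesgue borel f)
       = scale_measure (emeasure lebesgue {y. f y < 1}) (distr lebesgue borel g)"
    (is "?M = ?N")
proof (rule measure_eqI_generator_eq)
  have m: "f \<in> measurable lebesgue borel" "g \<in> measurable lebesgue borel"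
    using f(1) g(1) by (auto intro: measurable_completion)
  have le: "emeasure (distr lebesgue borel f) {..<r} = emeasure lebesgue {y. f y < r}"
    "emeasure (distr lebesgue borel g) {..<r} = emeasure lebesgue {y. g y < r}" for r :: real
    using m by (simp_all add: emeasure_distr vimage_def)
  show "Int_stable (range lessThan :: real set set)"
  proof (rule Int_stableI)
    fix X Y :: "real set" assume "X \<in> range lessThan" "Y \<in> range lessThan"
    then obtain r s where "X = {..<r}" "Y = {..<s}" by blast
    then have "X \<inter> Y = {..<min r s}" by auto
    then show "X \<inter> Y \<in> range lessThan" by blast
  qed
  show "range lessThan \<subseteq> Pow (UNIV :: real set)" by auto
  show "sets ?M = sigma_sets UNIV (range lessThan)" "sets ?N = sigma_sets UNIV (range lessThan)"
    by (simp_all add: borel_Iio)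
  have "emeasure ?M {..<r} = emeasure ?N {..<r}" for r
  proof (cases "r > 0")
    case True
    then show ?thesis
      by (simp add: le homogeneous_sublevel_volume[of f, OF f(3) True]
          homogeneous_sublevel_volume[of g, OF g(3) True] mult_ac)
  next
    case False
    then have "{y. f y < r} = {}" "{y. g y < r} = {}"
      using f(2) g(2) by (auto simp: not_less intro: order_trans)
    then show ?thesis by (simp add: le)
  qed
  then show "emeasure ?M X = emeasure ?N X" if "X \<in> range lessThan" for X using that by auto
  show "range (\<lambda>n. {..<real n}) \<subseteq> range lessThan" by auto
  show "(\<Union>n. {..<real n}) = UNIV" using reals_Archimedean2 by auto
  have "emeasure lebesgue {y. f y < real n} < \<infinity>" for n
  proof (cases n)
    case 0
    then have "{y. f y < real n} = {}" using f(2) by (auto simp: not_less)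
    then show ?thesis by (simp only: emeasure_empty) simp
  next
    case (Suc k)
    then show ?thesis
      using homogeneous_sublevel_volume[of f "real n", OF f(3)] fin(1)
      by (simp add: ennreal_mult_less_top)
  qed
  then have "emeasure ?M {..<real n} < \<infinity>" for n
    using fin(2) by (simp add: le ennreal_mult_less_top)
  then show "emeasure ?M {..<real n} \<noteq> \<infinity>" for n
    by (rule less_imp_neq)
qed

text \<open>Exponent \<open>3\<close> makes this function of class C^2, as much as the symmetry of second derivatives needs.
  The lower end \<open>1\<close> of its support keeps the integrand constant near the zero section, where a Finsler
  metric is not differentiable; the upper end \<open>2\<close> makes the domain of integration bounded.\<close>

definition bump :: "real \<Rightarrow> real" where
  "bump t = (max 0 ((t - 1) * (2 - t))) ^ 3"

lemma bump_nonneg: "0 \<le> bump t" by (simp add: bump_def)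

lemma bump_eq_0: "t \<le> 1 \<or> 2 \<le> t \<Longrightarrow> bump t = 0"
  by (auto simp: bump_def max_def zero_le_mult_iff)

lemma continuous_on_bump: "continuous_on S f \<Longrightarrow> continuous_on S (\<lambda>x. bump (f x))"
  unfolding bump_def by (intro continuous_intros)

lemma nn_integral_bump:
  fixes f :: "'a::euclidean_space \<Rightarrow> real"
  assumes f: "continuous_on UNIV f" and out: "\<And>y. y \<notin> cbox a b \<Longrightarrow> 2 \<le> f y"
  shows "(\<integral>\<^sup>+ y. ennreal (bump (f y)) \<partial>lebesgue) = ennreal (integral (cbox a b) (\<lambda>y. bump (f y)))"
proof -
  have c: "continuous_on UNIV (\<lambda>y. bump (f y))" by (rule continuous_on_bump[OF f])
  have "((\<lambda>y. bump (f y)) has_integral integral (cbox a b) (\<lambda>y. bump (f y))) (cbox a b)"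
    by (intro integrable_integral integrable_continuous continuous_on_subset[OF c]) simp
  then have "((\<lambda>y. bump (f y)) has_integral integral (cbox a b) (\<lambda>y. bump (f y))) UNIV"
    by (rule has_integral_on_superset) (use out in \<open>auto simp: bump_eq_0\<close>)
  then have "(\<integral>\<^sup>+ y. ennreal (bump (f y)) \<partial>lborel) = ennreal (integral (cbox a b) (\<lambda>y. bump (f y)))"
    by (intro nn_integral_has_integral_lborel borel_measurable_continuous_onI c bump_nonneg)
  then show ?thesis by (simp add: nn_integral_completion)
qed

lemma integral_bump_pos:
  fixes f :: "'a::euclidean_space \<Rightarrow> real"
  assumes f: "continuous_on UNIV f" and out: "\<And>y. y \<notin> cbox a b \<Longrightarrow> 2 \<le> f y"
    and y: "f y = 3/2"
  shows "0 < integral (cbox a b) (\<lambda>y. bump (f y))"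
proof -
  have c: "continuous_on (cbox a b) (\<lambda>y. bump (f y))"
    using continuous_on_bump[OF f] continuous_on_subset by blast
  have "open {y. f y < 2}" using open_Collect_less[OF f continuous_on_const] .
  moreover have sub: "{y. f y < 2} \<subseteq> cbox a b" using out by force
  ultimately have "{y. f y < 2} \<subseteq> box a b" by (metis interior_cbox interior_maximal)
  then have ne: "y \<in> box a b" using y by auto
  have "bump (f y) \<noteq> 0" by (simp add: bump_def y)
  then have "integral (cbox a b) (\<lambda>y. bump (f y)) \<noteq> 0"
    using integral_cbox_eq_0_iff[OF c] bump_nonneg ne box_subset_cbox by blast
  moreover have "0 \<le> integral (cbox a b) (\<lambda>y. bump (f y))"
    by (intro integral_nonneg integrable_continuous c bump_nonneg)
  ultimately show ?thesis by simp
qed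

text \<open>Integrating the bump function against the two proportional push-forwards of \<open>f\<close> and of the Euclidean
  norm gives the ratio of the unit ball volumes. The constant \<open>\<kappa>\<close> is the integral for the norm; what
  matters is that it serves all \<open>f\<close> and all boxes at once.\<close>

lemma homogeneous_unit_ball_volume:
  shows "\<exists>\<kappa>>0. \<forall>(f :: 'a::euclidean_space \<Rightarrow> real) a b.
      continuous_on UNIV f \<longrightarrow> (\<forall>y. 0 \<le> f y) \<longrightarrow> (\<forall>t>0. \<forall>y. f (t *\<^sub>R y) = t * f y) \<longrightarrow>
      (\<exists>y. f y \<noteq> 0) \<longrightarrow> (\<forall>y. y \<notin> cbox a b \<longrightarrow> 2 \<le> f y) \<longrightarrow>
      0 < integral (cbox a b) (\<lambda>y. bump (f y)) \<and>
      measure lebesgue (ball (0::'a) 1) / measure lebesgue {y. f y < 1}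
        = \<kappa> / integral (cbox a b) (\<lambda>y. bump (f y))"
proof -
  obtain c :: 'a where c: "ball 0 2 \<subseteq> cbox (- c) c"
    using bounded_subset_cbox_symmetric[OF bounded_ball] by blast
  define \<kappa> where "\<kappa> = integral (cbox (- c) c) (\<lambda>y. bump (norm y))"
  have out: "2 \<le> norm y" if "y \<notin> cbox (- c) c" for y
    using c that by (force simp: subset_iff not_less)
  obtain u :: 'a where u: "norm u = 3/2"
    using vector_choose_size[of "3/2"] by auto
  have \<kappa>: "\<kappa> > 0"
    unfolding \<kappa>_def using integral_bump_pos[OF continuous_on_norm_id, of "- c" c u] out u by blast
  have ball: "{y::'a. norm y < 1} = ball 0 1" by (auto simp: dist_norm)
  have main: "0 < integral (cbox a b) (\<lambda>y. bump (f y)) \<and>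
      measure lebesgue (ball (0::'a) 1) / measure lebesgue {y. f y < 1}
        = \<kappa> / integral (cbox a b) (\<lambda>y. bump (f y))"
    if f: "continuous_on UNIV f" "\<And>y. 0 \<le> f y" "\<And>t y. t > 0 \<Longrightarrow> f (t *\<^sub>R y) = t * f y"
      and ne: "\<exists>y. f y \<noteq> 0" and outf: "\<And>y. y \<notin> cbox a b \<Longrightarrow> 2 \<le> f y"
    for f :: "'a \<Rightarrow> real" and a b
  proof -
    define I where "I = integral (cbox a b) (\<lambda>y. bump (f y))"
    obtain v where v: "f v > 0" using ne f(2) by (metis order_le_less)
    then have "f ((3/2 / f v) *\<^sub>R v) = 3/2" by (subst f(3)) auto
    then have I: "I > 0"
      unfolding I_def using integral_bump_pos[OF f(1), of a b] outf by blast
    have bm: "f \<in> borel_measurable borel" by (rule borel_measurable_continuous_onI[OF f(1)])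
    have meas: "f \<in> measurable lebesgue borel" using bm by (auto intro: measurable_completion)
    have fin: "emeasure lebesgue {y. f y < 1} < \<infinity>"
    proof -
      have "{y. f y < 1} \<subseteq> cbox a b" using outf by force
      then have "emeasure lebesgue {y. f y < 1} \<le> emeasure lebesgue (cbox a b)"
        by (intro emeasure_mono) auto
      also have "\<dots> < \<infinity>" by (simp add: emeasure_lborel_cbox_eq)
      finally show ?thesis .
    qed
    have fin1: "emeasure lebesgue (ball (0::'a) 1) < \<infinity>"
      using emeasure_lborel_ball_finite[of "0::'a" 1] by simp
    have bmm: "(\<lambda>t. ennreal (bump t)) \<in> borel_measurable borel"
      using borel_measurable_continuous_onI[OF continuous_on_bump[OF continuous_on_id]] by measurable
    have normm: "norm \<in> measurable lebesgue (borel :: real measure)"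
      by (auto intro!: measurable_completion)
    have "scale_measure (emeasure lebesgue (ball (0::'a) 1)) (distr lebesgue borel f)
       = scale_measure (emeasure lebesgue {y. f y < 1}) (distr lebesgue borel (norm :: 'a \<Rightarrow> real))"
      using homogeneous_distr_proportional[of f norm] bm f fin fin1 by (simp add: ball)
    then have "emeasure lebesgue (ball (0::'a) 1) * (\<integral>\<^sup>+ t. ennreal (bump t) \<partial>distr lebesgue borel f)
      = emeasure lebesgue {y. f y < 1} * (\<integral>\<^sup>+ t. ennreal (bump t) \<partial>distr lebesgue borel (norm :: 'a \<Rightarrow> real))"
      using arg_cong[of _ _ "\<lambda>M. \<integral>\<^sup>+ t. ennreal (bump t) \<partial>M"] bmm
      by (subst (1 2) nn_integral_scale_measure[symmetric]) auto
    then have "emeasure lebesgue (ball (0::'a) 1) * ennreal I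
      = emeasure lebesgue {y. f y < 1} * ennreal \<kappa>"
      using nn_integral_bump[OF f(1) outf] nn_integral_bump[OF continuous_on_norm_id out] bmm
      by (simp add: nn_integral_distr[OF meas] nn_integral_distr[OF normm] I_def \<kappa>_def)
    then have "measure lebesgue (ball (0::'a) 1) * I = measure lebesgue {y. f y < 1} * \<kappa>"
      using fin fin1 I \<kappa>
      by (simp add: emeasure_eq_ennreal_measure flip: ennreal_mult) 
    moreover have "measure lebesgue (ball (0::'a) 1) > 0"
      using content_ball_pos[of 1 "0::'a"] by simp
    ultimately have "measure lebesgue {y. f y < 1} \<noteq> 0"
      "measure lebesgue (ball (0::'a) 1) * I = measure lebesgue {y. f y < 1} * \<kappa>"
      using I by auto
    then show ?thesis using I \<kappa> by (simp add: I_def[symmetric] field_simps)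
  qed
  show ?thesis
    by (intro exI[of _ \<kappa>] conjI[OF \<kappa>] allI impI, rule main) simp_all
qed

lemma Ck_on_imp_continuous_on: "Ck_on k f S \<Longrightarrow> continuous_on S f"
  by (cases k) (auto intro!: differentiable_imp_continuous_on differentiable_at_imp_differentiable_on)

text \<open>Induction on the order, with the Leibniz rule in each step: the derivative of the integral is again a
  parametric integral, of a function that is one order less differentiable.\<close>

lemma Ck_on_parametric_integral:
  fixes g :: "'a::euclidean_space \<times> 'b::euclidean_space \<Rightarrow> real"
  assumes W: "open W"
  shows "Ck_on k g (W \<times> UNIV) \<Longrightarrow> Ck_on k (\<lambda>x. integral (cbox a b) (\<lambda>y. g (x, y))) W"
proof (induction k arbitrary: g)
  case 0
  then have "continuous_on (W \<times> cbox a b) (\<lambda>(x, y). g (x, y))"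
    by (auto simp: case_prod_unfold intro: continuous_on_subset)
  from integral_continuous_on_param[OF this] show ?case by simp
next
  case (Suc k)
  let ?D = "\<lambda>z v. frechet_derivative g (at z) (v, 0)"
  have g0: "continuous_on (W \<times> UNIV) g"
    using Suc.prems by (rule Ck_on_imp_continuous_on)
  have D0: "continuous_on (W \<times> UNIV) (\<lambda>z. ?D z v)" for v
  proof -
    have "Ck_on k (\<lambda>z. ?D z v) (W \<times> UNIV)" using Suc.prems by simp
    then show ?thesis by (rule Ck_on_imp_continuous_on)
  qed
  show ?case
  proof (rule Ck_on_SucI[OF W, where D="\<lambda>x v. integral (cbox a b) (\<lambda>y. ?D (x, y) v)"])
    show "Ck_on k (\<lambda>x. integral (cbox a b) (\<lambda>y. ?D (x, y) v)) W" for v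
      using Suc.prems by (intro Suc.IH[of "\<lambda>z. ?D z v"]) simp
    fix x0 assume "x0 \<in> W"
    then obtain \<epsilon> where \<epsilon>: "\<epsilon> > 0" "ball x0 \<epsilon> \<subseteq> W" using W openE by blast
    have der: "((\<lambda>x. g (x, y)) has_derivative ?D (x, y)) (at x)" if "x \<in> W" for x y
    proof -
      have "(g has_derivative frechet_derivative g (at (x, y))) (at (x, y))"
        by (rule Ck_on_has_derivative[OF Suc.prems]) (use that in simp)
      moreover have "((\<lambda>x. (x, y)) has_derivative (\<lambda>v. (v, 0))) (at x)"
        by (auto intro!: derivative_eq_intros)
      ultimately show ?thesis by (rule has_derivative_compose[rotated])
    qed
    define B where "B x y = Blinfun (?D (x, y))" for x y
    have B: "blinfun_apply (B x y) = ?D (x, y)" if "x \<in> W" for x y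
      using has_derivative_bounded_linear[OF der[OF that]]
      by (simp add: B_def bounded_linear_Blinfun_apply)
    have contB: "continuous_on (ball x0 \<epsilon> \<times> cbox a b) (\<lambda>(x, y). B x y)"
    proof (rule continuous_on_blinfun_componentwise)
      fix i :: 'a
      have "continuous_on (ball x0 \<epsilon> \<times> cbox a b) (\<lambda>z. ?D z i)"
        using \<epsilon> by (auto intro: continuous_on_subset[OF D0])
      then show "continuous_on (ball x0 \<epsilon> \<times> cbox a b) (\<lambda>z. blinfun_apply (case z of (x, y) \<Rightarrow> B x y) i)"
        by (rule continuous_on_eq) (use \<epsilon> B in auto)
    qed
    have "((\<lambda>x. integral (cbox a b) (\<lambda>y. g (x, y))) has_derivative
        blinfun_apply (integral (cbox a b) (B x0))) (at x0 within ball x0 \<epsilon>)"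
    proof (rule leibniz_rule[OF _ _ contB])
      show "((\<lambda>x. g (x, y)) has_derivative blinfun_apply (B x y)) (at x within ball x0 \<epsilon>)"
        if "x \<in> ball x0 \<epsilon>" for x y
      proof -
        have "x \<in> W" using that \<epsilon>(2) by blast
        from has_derivative_at_withinI[OF der[OF this]] B[OF this] show ?thesis by simp
      qed
      show "(\<lambda>y. g (x, y)) integrable_on cbox a b" if "x \<in> ball x0 \<epsilon>" for x
      proof (rule integrable_continuous)
        show "continuous_on (cbox a b) (\<lambda>y. g (x, y))"
          by (rule continuous_on_compose2[of "W \<times> UNIV" g]) (use g0 that \<epsilon> in \<open>auto intro!: continuous_intros\<close>)
      qed
    qed (use \<epsilon> in auto)
    then have "((\<lambda>x. integral (cbox a b) (\<lambda>y. g (x, y))) has_derivative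
        blinfun_apply (integral (cbox a b) (B x0))) (at x0)"
      using at_within_open[of x0 "ball x0 \<epsilon>"] \<epsilon>(1) by simp
    moreover have "blinfun_apply (integral (cbox a b) (B x0)) = (\<lambda>v. integral (cbox a b) (\<lambda>y. ?D (x0, y) v))"
    proof
      fix v
      have "continuous_on (cbox a b) (\<lambda>y. case (x0, y) of (x, y) \<Rightarrow> B x y)"
        by (rule continuous_on_compose2[OF contB]) (use \<epsilon> in \<open>auto intro!: continuous_intros\<close>)
      then have "B x0 integrable_on cbox a b" by (simp add: integrable_continuous)
      from integral_linear[OF this blinfun.bounded_linear_left[of v], unfolded o_def]
      show "blinfun_apply (integral (cbox a b) (B x0)) v = integral (cbox a b) (\<lambda>y. ?D (x0, y) v)"
        unfolding B[OF \<open>x0 \<in> W\<close>] by (rule sym)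
    qed
    ultimately show "((\<lambda>x. integral (cbox a b) (\<lambda>y. g (x, y))) has_derivative
        (\<lambda>v. integral (cbox a b) (\<lambda>y. ?D (x0, y) v))) (at x0)"
      by (rule has_derivative_eq_rhs)
  qed
qed

section \<open>Finsler metrics in coordinates\<close>

lemma partial_vertical:
  fixes f :: "(real^'n::finite) \<times> (real^'n) \<Rightarrow> real"
  assumes "f differentiable (at z)"
  shows "partial (0, w) f z = (\<Sum>i\<in>UNIV. w $ i * pdy i f z)"
proof -
  let ?D = "frechet_derivative f (at z)"
  have lin: "linear ?D" using assms linear_frechet_derivative by blast
  have "((0, w) :: (real^'n) \<times> (real^'n)) = (\<Sum>i\<in>UNIV. w $ i *\<^sub>R (0, axis i 1))"
  proof -
    have "(\<Sum>i\<in>UNIV. w $ i *\<^sub>R axis i 1) = w"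
      unfolding scalar_mult_eq_scaleR[symmetric] by (rule basis_expansion)
    then show ?thesis by (simp add: prod_eq_iff fst_sum snd_sum)
  qed
  then have "?D (0, w) = ?D (\<Sum>i\<in>UNIV. w $ i *\<^sub>R (0, axis i 1))" by (rule arg_cong)
  also have "\<dots> = (\<Sum>i\<in>UNIV. w $ i *\<^sub>R ?D (0, axis i 1))"
    unfolding linear_sum[OF lin] linear_scale[OF lin] ..
  finally have "?D (0, w) = (\<Sum>i\<in>UNIV. w $ i *\<^sub>R ?D (0, axis i 1))" .
  then show ?thesis using assms by (simp add: partial_eq_frechet_derivative)
qed

text \<open>Euler's identity for the 2-homogeneous function \<open>L\<^sup>2\<close>, applied twice. Together with positive
  definiteness it shows that a Finsler metric is positive off the zero section.\<close>

lemma homogeneous_square_eq_fund_tensor: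
  fixes L :: "(real^'n::finite) \<times> (real^'n) \<Rightarrow> real"
  assumes S: "open S" "(x, y) \<in> S" and L: "smooth_on S L"
    and hom: "\<And>t. t > 0 \<Longrightarrow> L (x, t *\<^sub>R y) = t * L (x, y)"
  shows "(L (x, y))\<^sup>2 = (\<Sum>i\<in>UNIV. \<Sum>j\<in>UNIV. fund_tensor L i j (x, y) * y $ i * y $ j)"
proof -
  define E where "E = (\<lambda>w. (L w)\<^sup>2)"
  have E: "smooth_on S E"
    unfolding E_def power2_eq_square by (intro smooth_on_mult S L)
  \<comment> \<open>Here \<open>y\<close> is a fixed direction, and \<open>E\<close> is quadratic along the ray through \<open>y\<close>.\<close>
  have first: "partial (0, y) E (x, s *\<^sub>R y) = 2 * s * E (x, y)" if "s > 0" for s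
  proof -
    have "((\<lambda>t. (s + t)\<^sup>2 * E (x, y)) has_real_derivative 2 * s * E (x, y)) (at 0)"
      by (auto intro!: derivative_eq_intros)
    then have "((\<lambda>t. E ((x, s *\<^sub>R y) + t *\<^sub>R (0, y))) has_real_derivative 2 * s * E (x, y)) (at 0)"
    proof (rule has_field_derivative_transform_within_open[of _ _ _ "{-s<..}"])
      fix t assume "t \<in> {-s<..}"
      then have "L (x, (s + t) *\<^sub>R y) = (s + t) * L (x, y)" by (intro hom) auto
      then show "(s + t)\<^sup>2 * E (x, y) = E ((x, s *\<^sub>R y) + t *\<^sub>R (0, y))"
        by (simp add: E_def power_mult_distrib flip: scaleR_left_distrib)
    qed (use that in auto)
    then show ?thesis unfolding partial_def by (rule DERIV_imp_deriv)
  qed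
  have "((\<lambda>t. 2 * (1 + t) * E (x, y)) has_real_derivative 2 * E (x, y)) (at 0)"
    by (auto intro!: derivative_eq_intros)
  then have "((\<lambda>t. partial (0, y) E ((x, y) + t *\<^sub>R (0, y))) has_real_derivative 2 * E (x, y)) (at 0)"
  proof (rule has_field_derivative_transform_within_open[of _ _ _ "{-1<..}"])
    fix t :: real assume "t \<in> {-1<..}"
    then have "partial (0, y) E (x, (1 + t) *\<^sub>R y) = 2 * (1 + t) * E (x, y)" by (intro first) auto
    then show "2 * (1 + t) * E (x, y) = partial (0, y) E ((x, y) + t *\<^sub>R (0, y))"
      by (simp add: scaleR_left_distrib)
  qed auto
  then have "2 * E (x, y) = partial (0, y) (partial (0, y) E) (x, y)"
    unfolding partial_def[of "(0, y)" "partial (0, y) E"] by (simp add: DERIV_imp_deriv)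
  also have "\<dots> = partial (0, y) (\<lambda>z. \<Sum>i\<in>UNIV. y $ i * pdy i E z) (x, y)"
    by (rule partial_cong_open[OF S]) (intro partial_vertical smooth_on_differentiable[OF E])
  also have "\<dots> = (\<Sum>i\<in>UNIV. partial (0, y) (\<lambda>z. y $ i * pdy i E z) (x, y))"
    by (intro partial_sum smooth_on_differentiable[OF _ S(2)] smooth_on_cmult smooth_on_partial E S)
  also have "\<dots> = (\<Sum>i\<in>UNIV. y $ i * (\<Sum>j\<in>UNIV. y $ j * pdy j (pdy i E) (x, y)))"
  proof (intro sum.cong refl)
    fix i
    have "pdy i E differentiable (at (x, y))"
      by (intro smooth_on_differentiable[OF _ S(2)] smooth_on_partial E S)
    then show "partial (0, y) (\<lambda>z. y $ i * pdy i E z) (x, y)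
        = y $ i * (\<Sum>j\<in>UNIV. y $ j * pdy j (pdy i E) (x, y))"
      by (simp add: partial_cmult partial_vertical)
  qed
  also have "\<dots> = 2 * (\<Sum>i\<in>UNIV. \<Sum>j\<in>UNIV. fund_tensor L i j (x, y) * y $ i * y $ j)"
    by (simp add: fund_tensor_def E_def sum_distrib_left mult_ac)
  finally show ?thesis by (simp add: E_def)
qed

text \<open>Compactness of a ball times the unit sphere gives the bounds for \<open>norm y = 1\<close>; homogeneity extends
  them to all \<open>y\<close>.\<close>

lemma homogeneous_locally_uniform_bounds:
  fixes L :: "(real^'n::finite) \<times> (real^'n) \<Rightarrow> real"
  assumes U: "open U" "x0 \<in> U" and cont: "continuous_on (U \<times> - {0}) L"
    and hom: "\<And>x y t. x \<in> U \<Longrightarrow> t > 0 \<Longrightarrow> L (x, t *\<^sub>R y) = t * L (x, y)"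
    and pos: "\<And>x y. x \<in> U \<Longrightarrow> y \<noteq> 0 \<Longrightarrow> L (x, y) > 0"
  shows "\<exists>\<epsilon> m K. \<epsilon> > 0 \<and> m > 0 \<and> K > 0 \<and> ball x0 \<epsilon> \<subseteq> U \<and>
    (\<forall>x\<in>ball x0 \<epsilon>. \<forall>y. m * norm y \<le> L (x, y) \<and> L (x, y) \<le> K * norm y)"
proof -
  obtain \<epsilon> where \<epsilon>: "\<epsilon> > 0" "cball x0 \<epsilon> \<subseteq> U" using U open_contains_cball by blast
  let ?C = "cball x0 \<epsilon> \<times> sphere (0 :: real^'n) 1"
  have C: "compact ?C" by (intro compact_Times compact_cball compact_sphere)
  have ne: "?C \<noteq> {}"
    using \<epsilon> vector_choose_size[of 1, where 'a="real^'n"] by (auto simp: ex_in_conv[symmetric])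
  have cont': "continuous_on ?C L" by (rule continuous_on_subset[OF cont]) (use \<epsilon> in auto)
  obtain p where p: "p \<in> ?C" "\<And>q. q \<in> ?C \<Longrightarrow> L p \<le> L q"
    using continuous_attains_inf[OF C ne cont'] by blast
  obtain r where r: "r \<in> ?C" "\<And>q. q \<in> ?C \<Longrightarrow> L q \<le> L r"
    using continuous_attains_sup[OF C ne cont'] by blast
  have scale: "L p * norm y \<le> L (x, y) \<and> L (x, y) \<le> L r * norm y" if x: "x \<in> ball x0 \<epsilon>" for x y
  proof (cases "y = 0")
    case True
    have "x \<in> U" using x \<epsilon> by auto
    from hom[OF this, of 2 0] have "L (x, 0) = 0" by simp
    then show ?thesis using True by simp
  next
    case False
    then have "L (x, y) = norm y * L (x, inverse (norm y) *\<^sub>R y)"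
      using hom[of x "norm y" "inverse (norm y) *\<^sub>R y"] x \<epsilon> by (auto simp: subset_iff)
    moreover have "(x, inverse (norm y) *\<^sub>R y) \<in> ?C" using x False by auto
    ultimately show ?thesis
      using p(2)[of "(x, inverse (norm y) *\<^sub>R y)"] r(2)[of "(x, inverse (norm y) *\<^sub>R y)"]
      by (simp add: mult.commute[of _ "norm y"] mult_left_mono)
  qed
  have "L q > 0" if "q \<in> ?C" for q
  proof -
    have "fst q \<in> cball x0 \<epsilon>" "norm (snd q) = 1" using that by (simp_all add: mem_Times_iff)
    then have "fst q \<in> U" "snd q \<noteq> 0" using \<epsilon>(2) by auto
    then show ?thesis using pos[of "fst q" "snd q"] by simp
  qed
  then have "L p > 0" "L r > 0" using p(1) r(1) by blast+
  moreover have "ball x0 \<epsilon> \<subseteq> U" using \<epsilon>(2) ball_subset_cball by blast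
  ultimately show ?thesis using \<epsilon>(1) scale by blast
qed

text \<open>Near \<open>x0\<close> the density is \<open>\<kappa> / I x\<close>, where \<open>I x\<close> integrates the bump function of \<open>L (x, \<cdot>)\<close> over a
  box that does not depend on \<open>x\<close>.\<close>

lemma Ck_on_ln_BH_density:
  fixes L :: "(real^'n::finite) \<times> (real^'n) \<Rightarrow> real"
  assumes U: "open U" "x0 \<in> U" and L: "smooth_on (U \<times> - {0}) L"
    and hom: "\<And>x y t. x \<in> U \<Longrightarrow> t > 0 \<Longrightarrow> L (x, t *\<^sub>R y) = t * L (x, y)"
    and pos: "\<And>x y. x \<in> U \<Longrightarrow> y \<noteq> 0 \<Longrightarrow> L (x, y) > 0"
  shows "\<exists>W. open W \<and> x0 \<in> W \<and> Ck_on 2 (\<lambda>x. ln (BH_density L x)) W"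
proof -
  have cont: "continuous_on (U \<times> - {0}) L"
    using L[unfolded smooth_on_def, rule_format, of 0] by simp
  obtain \<epsilon> m K where \<epsilon>: "\<epsilon> > 0" and mK: "m > 0" "K > 0" and W: "ball x0 \<epsilon> \<subseteq> U"
    and lower: "\<And>x y. x \<in> ball x0 \<epsilon> \<Longrightarrow> m * norm y \<le> L (x, y)"
    and upper: "\<And>x y. x \<in> ball x0 \<epsilon> \<Longrightarrow> L (x, y) \<le> K * norm y"
  proof -
    have "\<exists>\<epsilon> m K. \<epsilon> > 0 \<and> m > 0 \<and> K > 0 \<and> ball x0 \<epsilon> \<subseteq> U \<and>
      (\<forall>x\<in>ball x0 \<epsilon>. \<forall>y. m * norm y \<le> L (x, y) \<and> L (x, y) \<le> K * norm y)"
      by (rule homogeneous_locally_uniform_bounds[OF U cont]) (use hom pos in auto)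
    then show thesis using that by blast
  qed
  let ?W = "ball x0 \<epsilon>"
  obtain c :: "real^'n" where c: "ball 0 (2 / m) \<subseteq> cbox (- c) c"
    using bounded_subset_cbox_symmetric[OF bounded_ball] by blast
  have out: "2 \<le> L (x, y)" if "x \<in> ?W" "y \<notin> cbox (- c) c" for x y
  proof -
    have "2 / m \<le> norm y" using c that(2) by (force simp: subset_iff not_less)
    then have "2 \<le> m * norm y" using mK by (simp add: field_simps)
    then show ?thesis using lower[OF that(1), of y] by simp
  qed
  define I where "I x = integral (cbox (- c) c) (\<lambda>y. bump (L (x, y)))" for x
  have "\<exists>\<kappa>>0. \<forall>(f :: real^'n \<Rightarrow> real) a b.
      continuous_on UNIV f \<longrightarrow> (\<forall>y. 0 \<le> f y) \<longrightarrow> (\<forall>t>0. \<forall>y. f (t *\<^sub>R y) = t * f y) \<longrightarrow>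
      (\<exists>y. f y \<noteq> 0) \<longrightarrow> (\<forall>y. y \<notin> cbox a b \<longrightarrow> 2 \<le> f y) \<longrightarrow>
      0 < integral (cbox a b) (\<lambda>y. bump (f y)) \<and>
      measure lebesgue (ball (0::real^'n) 1) / measure lebesgue {y. f y < 1}
        = \<kappa> / integral (cbox a b) (\<lambda>y. bump (f y))"
    by (rule homogeneous_unit_ball_volume)
  then obtain \<kappa> where \<kappa>: "\<kappa> > 0" and ratio: "\<forall>(f :: real^'n \<Rightarrow> real) a b.
      continuous_on UNIV f \<longrightarrow> (\<forall>y. 0 \<le> f y) \<longrightarrow> (\<forall>t>0. \<forall>y. f (t *\<^sub>R y) = t * f y) \<longrightarrow>
      (\<exists>y. f y \<noteq> 0) \<longrightarrow> (\<forall>y. y \<notin> cbox a b \<longrightarrow> 2 \<le> f y) \<longrightarrow>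
      0 < integral (cbox a b) (\<lambda>y. bump (f y)) \<and>
      measure lebesgue (ball (0::real^'n) 1) / measure lebesgue {y. f y < 1}
        = \<kappa> / integral (cbox a b) (\<lambda>y. bump (f y))"
    by blast
  have dens: "0 < I x \<and> BH_density L x = \<kappa> / I x" if x: "x \<in> ?W" for x
    unfolding I_def BH_density_def
  proof (rule ratio[rule_format])
    have xU: "x \<in> U" using x W by blast
    have "isCont (\<lambda>y. L (x, y)) y" for y
    proof (cases "y = 0")
      case False
      have "continuous_on (- {0}) (\<lambda>y. L (x, y))"
        by (rule continuous_on_compose2[OF cont]) (use xU in \<open>auto intro!: continuous_intros\<close>)
      then have "\<forall>y\<in>- {0}. isCont (\<lambda>y. L (x, y)) y"
        by (subst (asm) continuous_on_eq_continuous_at) auto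
      then show ?thesis using False by blast
    next
      case True
      have 0: "L (x, 0) = 0" using lower[OF x, of 0] upper[OF x, of 0] by simp
      have K0: "((\<lambda>y :: real^'n. K * norm y) \<longlongrightarrow> 0) (at 0)"
        by (auto intro!: tendsto_eq_intros)
      have "((\<lambda>y. L (x, y)) \<longlongrightarrow> 0) (at 0)"
      proof (rule tendsto_sandwich[OF _ _ tendsto_const K0])
        have "0 \<le> L (x, y)" for y
          using lower[OF x, of y] mK by (meson mult_nonneg_nonneg norm_ge_zero order.trans less_imp_le)
        then show "\<forall>\<^sub>F y in at 0. 0 \<le> L (x, y)" by simp
      qed (use upper[OF x] in auto)
      then show ?thesis using True 0 by (simp add: isCont_def)
    qed
    then show "continuous_on UNIV (\<lambda>y. L (x, y))" by (simp add: continuous_at_imp_continuous_on)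
    show "0 \<le> L (x, y)" for y
      using lower[OF x, of y] mK by (meson mult_nonneg_nonneg norm_ge_zero order.trans less_imp_le)
    show "\<exists>y. L (x, y) \<noteq> 0"
      using pos[OF xU, of "axis undefined 1"] by (auto simp: axis_eq_0_iff intro!: exI[of _ "axis undefined 1"])
  qed (use x W hom out in auto)
  \<comment> \<open>The integrand is a power of a positive part off the zero section and vanishes where \<open>L \<le> 1\<close>; the two open sets cover everything.\<close>
  have "Ck_on 2 (\<lambda>z. bump (L z)) (?W \<times> - {0} \<union> ?W \<times> ball 0 (1 / K))"
  proof (rule Ck_on_Un)
    have op: "open (?W \<times> - {0 :: real^'n})" by (intro open_Times) auto
    have L2: "Ck_on 2 L (?W \<times> - {0})"
      by (rule Ck_on_subset[of 2 L "U \<times> - {0}"]) (use L W in \<open>auto simp: smooth_on_def\<close>)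
    have "Ck_on 2 (\<lambda>z. (L z + (- 1)) * (2 + (- 1) * L z)) (?W \<times> - {0})"
      by (intro Ck_on_mult Ck_on_add Ck_on_const op L2)
    from Ck_on_pos_part_power[OF op this]
    show "Ck_on 2 (\<lambda>z. bump (L z)) (?W \<times> - {0})" by (simp add: bump_def numeral_3_eq_3)
    have op2: "open (?W \<times> ball (0 :: real^'n) (1 / K))" by (intro open_Times) auto
    show "Ck_on 2 (\<lambda>z. bump (L z)) (?W \<times> ball 0 (1 / K))"
    proof (rule Ck_on_cong[OF op2 _ Ck_on_const[OF op2, of _ 0]])
      fix z assume "z \<in> ?W \<times> ball (0 :: real^'n) (1 / K)"
      then obtain x y where z: "z = (x, y)" "x \<in> ?W" "norm y < 1 / K" by auto
      then have "L (x, y) \<le> 1" using upper[of x y] mK by (simp add: field_simps)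
      then show "0 = bump (L z)" by (simp add: z bump_eq_0)
    qed
  qed (auto intro: open_Times)
  moreover have "?W \<times> - {0} \<union> ?W \<times> ball 0 (1 / K) = ?W \<times> (UNIV :: (real^'n) set)"
    using mK by auto
  ultimately have "Ck_on 2 (\<lambda>z. bump (L z)) (?W \<times> UNIV)" by simp
  from Ck_on_parametric_integral[OF open_ball this, of "- c" c]
  have "Ck_on 2 I ?W" unfolding I_def .
  moreover have Ipos: "0 < I x" if "x \<in> ?W" for x using dens[OF that] by blast
  moreover have "I x \<noteq> 0" if "x \<in> ?W" for x using Ipos[OF that] by simp
  ultimately have "Ck_on 2 (\<lambda>x. \<kappa> * inverse (I x)) ?W"
    by (intro Ck_on_mult Ck_on_const Ck_on_inverse open_ball)
  then have "Ck_on 2 (\<lambda>x. ln (\<kappa> * inverse (I x))) ?W"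
    using Ipos \<kappa> by (intro Ck_on_ln open_ball) auto
  then have "Ck_on 2 (\<lambda>x. ln (BH_density L x)) ?W"
    by (rule Ck_on_cong[OF open_ball, rotated]) (simp add: dens divide_inverse)
  then show ?thesis using \<epsilon> by (intro exI[of _ ?W]) simp
qed

section \<open>Passage to the manifold\<close>

lemma chart_inv_chart_range:
  assumes "x \<in> chart_range c"
  shows "chart_inv c x \<in> fst c" "snd c (chart_inv c x) = x"
  using assms inv_into_into[of x "snd c" "fst c"] f_inv_into_f[of x "snd c" "fst c"]
  by (auto simp: chart_inv_def chart_range_def)

context
  fixes M :: "'a topology" and A :: "('a, 'n::finite) chart set"
  assumes M: "smooth_manifold M A"
begin

lemma chart_facts:
  assumes c: "c \<in> A"
  shows "fst c \<subseteq> topspace M" "openin M (fst c)" "open (chart_range c)" "inj_on (snd c) (fst c)"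
    "open_map (subtopology M (fst c)) (top_of_set (chart_range c)) (snd c)"
proof -
  have ch: "is_chart M c" using M c by (simp add: smooth_manifold_def)
  then show op: "openin M (fst c)" "open (chart_range c)" by (auto simp: is_chart_def)
  show sub: "fst c \<subseteq> topspace M" using op(1) by (rule openin_subset)
  have hom: "homeomorphic_map (subtopology M (fst c)) (top_of_set (chart_range c)) (snd c)"
    using ch by (simp add: is_chart_def)
  show "open_map (subtopology M (fst c)) (top_of_set (chart_range c)) (snd c)"
    by (rule homeomorphic_imp_open_map[OF hom])
  show "inj_on (snd c) (fst c)"
    using homeomorphic_imp_injective_map[OF hom] sub by (simp add: Int_absorb1)
qed

lemma open_chart_overlap:
  assumes c: "c \<in> A" and d: "d \<in> A" shows "open (snd c ` (fst c \<inter> fst d))"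
proof -
  have "openin (subtopology M (fst c)) (fst c \<inter> fst d)"
    using chart_facts(2)[OF d] by (auto simp: openin_subtopology)
  then have "openin (top_of_set (chart_range c)) (snd c ` (fst c \<inter> fst d))"
    using chart_facts(5)[OF c] unfolding open_map_def by blast
  then show ?thesis using chart_facts(3)[OF c] by (rule openin_open_trans)
qed

lemma transition_differentiable:
  assumes c: "c \<in> A" and d: "d \<in> A" and p: "p \<in> fst c \<inter> fst d"
  shows "transition c d differentiable (at (snd c p))"
proof -
  have "smooth_on (snd c ` (fst c \<inter> fst d)) (transition c d)"
    using M c d by (simp add: smooth_manifold_def)
  then show ?thesis by (rule smooth_on_differentiable) (use p in blast)
qed

text \<open>The chain rule for transition maps. It is needed because homogeneity and nonnegativity of a
  Finsler metric are stated for members of the tangent spaces, not for coordinate expressions.\<close>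

lemma coord_tvec_in_tangent_space:
  assumes c: "c \<in> A" and x: "x \<in> chart_range c"
  shows "coord_tvec A c x y \<in> tangent_space A (chart_inv c x)"
proof -
  let ?p = "chart_inv c x"
  note p = chart_inv_chart_range[OF x]
  have cocycle: "frechet_derivative (transition c e) (at x) y =
      frechet_derivative (transition d e) (at (snd d ?p)) (frechet_derivative (transition c d) (at x) y)"
    if d: "d \<in> A" "?p \<in> fst d" and e: "e \<in> A" "?p \<in> fst e" for d e
  proof -
    have cd: "transition c d x = snd d ?p" by (simp add: transition_def)
    have inv: "chart_inv d (snd d q) = q" if "q \<in> fst d" for q
      using chart_facts(4)[OF d(1)] that by (simp add: chart_inv_def)
    have invc: "chart_inv c (snd c q) = q" if "q \<in> fst c" for q
      using chart_facts(4)[OF c] that by (simp add: chart_inv_def)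
    have "frechet_derivative (transition c e) (at x)
        = frechet_derivative (transition d e \<circ> transition c d) (at x)"
    proof (rule frechet_derivative_cong_open[OF open_chart_overlap[OF c d(1)]])
      show "x \<in> snd c ` (fst c \<inter> fst d)" using p d(2) by (metis IntI image_eqI)
    qed (auto simp: transition_def inv invc)
    also have "\<dots> = frechet_derivative (transition d e) (at (transition c d x))
        \<circ> frechet_derivative (transition c d) (at x)"
    proof (rule frechet_derivative_compose)
      show "transition c d differentiable at x"
        using transition_differentiable[OF c d(1), of ?p] p d by simp
      show "transition d e differentiable at (transition c d x)"
        unfolding cd using transition_differentiable[OF d(1) e(1), of ?p] d e by simp
    qed
    finally show ?thesis by (simp add: cd)
  qed
  show ?thesis
    unfolding tangent_space_def coord_tvec_def
  proof (intro CollectI conjI ballI allI impI)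
    fix d e assume "d \<in> A" "e \<in> A" and "?p \<in> fst d \<inter> fst e"
    with cocycle[of d e] show "(if e \<in> A \<and> ?p \<in> fst e then frechet_derivative (transition c e) (at x) y else 0) =
        frechet_derivative (transition d e) (at (snd d ?p))
          (if d \<in> A \<and> ?p \<in> fst d then frechet_derivative (transition c d) (at x) y else 0)"
      by simp
  qed auto
qed

lemma coord_tvec_scaleR:
  assumes c: "c \<in> A" and x: "x \<in> chart_range c"
  shows "coord_tvec A c x (t *\<^sub>R y) = (\<lambda>d. t *\<^sub>R coord_tvec A c x y d)"
proof
  fix d
  note p = chart_inv_chart_range[OF x]
  show "coord_tvec A c x (t *\<^sub>R y) d = t *\<^sub>R coord_tvec A c x y d"
  proof (cases "d \<in> A \<and> chart_inv c x \<in> fst d")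
    case True
    then have "transition c d differentiable (at x)"
      using transition_differentiable[OF c, of d "chart_inv c x"] p by simp
    then have "linear (frechet_derivative (transition c d) (at x))"
      by (rule linear_frechet_derivative)
    then show ?thesis by (simp add: coord_tvec_def linear_scale)
  qed (auto simp: coord_tvec_def)
qed

lemma finsler_metric_in_coordinates:
  assumes F: "finsler_metric M A F" and c: "c \<in> A"
  shows "smooth_on (slit_range c) (TM_rep A c F)"
    "\<And>x y t. x \<in> chart_range c \<Longrightarrow> t > 0 \<Longrightarrow> TM_rep A c F (x, t *\<^sub>R y) = t * TM_rep A c F (x, y)"
    "\<And>x y. x \<in> chart_range c \<Longrightarrow> y \<noteq> 0 \<Longrightarrow> TM_rep A c F (x, y) > 0"
    "\<And>z w. z \<in> slit_range c \<Longrightarrow> w \<noteq> 0 \<Longrightarrow>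
      (\<Sum>i\<in>UNIV. \<Sum>j\<in>UNIV. fund_tensor (TM_rep A c F) i j z * w $ i * w $ j) > 0"
proof -
  let ?L = "TM_rep A c F"
  show sm: "smooth_on (slit_range c) ?L" using F c by (simp add: finsler_metric_def)
  show pd: "(\<Sum>i\<in>UNIV. \<Sum>j\<in>UNIV. fund_tensor ?L i j z * w $ i * w $ j) > 0"
    if "z \<in> slit_range c" "w \<noteq> 0" for z w
    using F c that by (simp add: finsler_metric_def)
  have top: "chart_inv c x \<in> topspace M" if "x \<in> chart_range c" for x
    using chart_inv_chart_range[OF that] chart_facts(1)[OF c] by blast
  show hom: "?L (x, t *\<^sub>R y) = t * ?L (x, y)" if x: "x \<in> chart_range c" and "t > 0" for x y t
    using F top[OF x] coord_tvec_in_tangent_space[OF c x, of y] \<open>t > 0\<close>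
    by (simp add: TM_rep_def coord_tvec_scaleR[OF c x] finsler_metric_def)
  show "?L (x, y) > 0" if x: "x \<in> chart_range c" and y: "y \<noteq> 0" for x y
  proof -
    have z: "(x, y) \<in> slit_range c" using x y by (simp add: slit_range_def)
    have "open (slit_range c)"
      unfolding slit_range_def using chart_facts(3)[OF c] by (intro open_Times) auto
    from homogeneous_square_eq_fund_tensor[OF this z sm hom[OF x]] pd[OF z y]
    have "?L (x, y) \<noteq> 0" by auto
    moreover have "0 \<le> ?L (x, y)"
      using F top[OF x] coord_tvec_in_tangent_space[OF c x, of y]
      by (simp add: TM_rep_def finsler_metric_def)
    ultimately show ?thesis by simp
  qed
qed

lemma Z_tensor_eq_0:
  assumes F: "finsler_metric M A F" and c: "c \<in> A" and z: "z \<in> slit_range c"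
  shows "Z_tensor A F c j l z = 0"
proof -
  note L = finsler_metric_in_coordinates[OF F c]
  note U = chart_facts(3)[OF c]
  have S: "open (slit_range c)"
    unfolding slit_range_def using U by (intro open_Times) auto
  have x: "fst z \<in> chart_range c" using z by (auto simp: slit_range_def)
  obtain W where W: "open W" "fst z \<in> W" "Ck_on 2 (\<lambda>x. ln (BH_density (TM_rep A c F) x)) W"
  proof -
    have "\<exists>W. open W \<and> fst z \<in> W \<and> Ck_on 2 (\<lambda>x. ln (BH_density (TM_rep A c F) x)) W"
      by (rule Ck_on_ln_BH_density[OF U x L(1)[unfolded slit_range_def]]) (use L(2,3) in auto)
    then show thesis using that by blast
  qed
  have G: "smooth_on (slit_range c) (spray (TM_rep A c F) i)" for i
    by (rule smooth_on_spray[OF S L(1)]) (use L(4) in auto)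
  show ?thesis
    unfolding Z_tensor_def by (rule R_antisym_Sigma_cancel[OF S G z W])
qed

end

lemma lie_tensor_eq_0_on_open:
  assumes S: "open S" "z \<in> S" and T: "\<And>i j z. z \<in> S \<Longrightarrow> T i j z = 0"
  shows "lie_tensor W T i j z = 0"
proof -
  have "partial e (T a b) z = 0" for e a b
    using partial_cong_open[OF S, of "T a b" "\<lambda>_. 0" e] T by (simp add: partial_const)
  then show ?thesis by (simp add: lie_tensor_def complete_lift_def T S(2))
qed

theorem mainTheorem3:
  fixes M :: "'a topology"
    and A :: "('a, 'n::finite) chart set"
    and F :: "'a \<Rightarrow> ('a, 'n) tvec \<Rightarrow> real"
    and V :: "'a \<Rightarrow> ('a, 'n) tvec"
  assumes "smooth_manifold M A" and "connected_space M"
    and "finsler_metric M A F"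
    and "projective_vector_field M A F V"
  shows "lie_vanishes A V (Z_tensor A F)"
  unfolding lie_vanishes_def
proof (intro ballI allI)
  fix c z j l assume c: "c \<in> A" and z: "z \<in> slit_range c"
  have "open (slit_range c)"
    unfolding slit_range_def using chart_facts(3)[OF assms(1) c] by (intro open_Times) auto
  then show "lie_tensor (vf_rep c V) (Z_tensor A F c) j l z = 0"
    using z by (rule lie_tensor_eq_0_on_open) (rule Z_tensor_eq_0[OF assms(1,3) c])
qed

end
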